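(* Let $\xi$ be a random vector in $\mathbb{R}^d$ with probability density $f$ with respect to Lebesgue measure, let $X_1,X_2,\ldots$ be i.i.d. random vectors with the same law as $\xi$, and for $N\ge 2$ let $H_N$ be the Kozachenko–Leonenko estimate built from $X_1,\ldots,X_N$. Assume that, for some positive numbers $\varepsilon_0,\varepsilon_1,\varepsilon_2,R_1,R_2$, one has $K_f(\varepsilon_0)<\infty$, $Q_f(\varepsilon_1,R_1)<\infty$ and $T_f(\varepsilon_2,R_2)<\infty$. Then the estimates $H_N$ are asymptotically unbiased, i.e. $$\lim_{N\to\infty}\mathsf{E}\,H_N=H,$$ where $H=H(f)$ is the differential Shannon entropy of $f$.
   Context: All random vectors are defined on a complete probability space. $\rho(x,y)$ is the Euclidean distance in $\mathbb{R}^d$, $B(x,r)=\{y:\rho(x,y)\le r\}$, $V_d=\pi^{d/2}/\Gamma(\tfrac d2+1)$ is the volume of the unit ball, $\log$ is the natural logarithm, and $\gamma=-\int_0^\infty e^{-t}\log t\,dt$ is the Euler constant. Entropy: $H(f)=-\int_{\mathbb{R}^d}f(x)\log f(x)\,dx$, with $0\log 0:=0$. Estimate: for $N\ge2$ and $i=1,\ldots,N$ let $\rho_i=\min\{\rho(X_i,X_j): j\in\{1,\ldots,N\}\setminus\{i\}\}$, $\overline{\rho}=(\rho_1\cdots\rho_N)^{1/N}$, and $$H_N=d\log\overline{\rho}+\log V_d+\gamma+\log(N-1).$$ Functionals: let $G(t)=0$ for $0\le t<1$ and $G(t)=t\log t$ for $t\ge1$. For $x\in\mathbb{R}^d$, $r,R>0$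 put $$I_f(x,r)=\frac{1}{r^dV_d}\int_{B(x,r)}f(y)\,dy,\quad M_f(x,R)=\sup_{r\in(0,R]}I_f(x,r),\quad m_f(x,R)=\inf_{r\in(0,R]}I_f(x,r).$$ For positive $\varepsilon_0,\varepsilon_1,\varepsilon_2,R_1,R_2$ define (with values in $[0,\infty]$) $$K_f(\varepsilon_0)=\int_{\mathbb{R}^d}\Big(\int_{\mathbb{R}^d}G\big(|\log\rho(x,y)|\big)f(y)\,dy\Big)^{1+\varepsilon_0}f(x)\,dx,$$ $$Q_f(\varepsilon_1,R_1)=\int_{\mathbb{R}^d}M_f(x,R_1)^{\varepsilon_1}f(x)\,dx,\qquad T_f(\varepsilon_2,R_2)=\int_{\mathbb{R}^d}m_f(x,R_2)^{-\varepsilon_2}f(x)\,dx,$$ with the conventions $\log 0:=-\infty$, $G(\infty):=\infty$, $1/0:=\infty$; the integrals in $x$ may equivalently be taken over $S(f)=\{x:f(x)>0\}$, and do not depend on the version of $f$. *)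

theory Defs
  imports "HOL-Probability.Probability"
begin

text \<open>
  The space \<open>\<real>\<^sup>d\<close> is an arbitrary Euclidean space \<open>'a\<close> with \<open>d = DIM('a)\<close>.
\<close>

definition shannon_entropy :: "('a::euclidean_space \<Rightarrow> real) \<Rightarrow> real" where
  "shannon_entropy f = - (\<integral>x. f x * ln (f x) \<partial>lborel)"

definition nn_dist :: "nat \<Rightarrow> (nat \<Rightarrow> 'a::euclidean_space) \<Rightarrow> nat \<Rightarrow> real" where
  "nn_dist N x i = Min ((\<lambda>j. dist (x i) (x j)) ` ({1..N} - {i}))"

text \<open>
  If two sample points coincide, the logarithm below is \<open>ln 0 = 0\<close>; for a sample from a
  distribution with a density this happens with probability \<open>0\<close>.
\<close>

definition KL_estimate :: "nat \<Rightarrow> (nat \<Rightarrow> 'a::euclidean_space) \<Rightarrow> real" where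
  "KL_estimate N x =
     real DIM('a) * ln ((\<Prod>i=1..N. nn_dist N x i) powr (1 / real N))
     + ln (unit_ball_vol (real DIM('a))) + euler_mascheroni + ln (real N - 1)"

text \<open>
  The library's \<^const>\<open>euler_mascheroni\<close> is the limit of \<open>harm n - ln n\<close>; the lemma
  \<open>euler_mascheroni_integral\<close> below shows that it is the constant
  \<open>- \<integral> exp (- t) * ln t dt\<close>, integrated over \<open>t > 0\<close>.
\<close>

lemma integrable_Gamma:
  fixes a :: real
  assumes "a > 0"
  shows "integrable lborel (\<lambda>t. indicator {0..} t * t powr (a - 1) / exp t :: real)"
    and "(\<integral>t. indicator {0..} t * t powr (a - 1) / exp t \<partial>lborel) = (Gamma a :: real)"
proof -
  have *: "Gamma a = nn_integral lborel (\<lambda>t. ennreal (indicator {0..} t * t powr (a - 1) / exp t))"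
    by (rule Gamma_conv_nn_integral_real[OF assms])
  have "has_bochner_integral lborel (\<lambda>t. indicator {0..} t * t powr (a - 1) / exp t :: real) (Gamma a)"
    by (rule has_bochner_integral_nn_integral)
       (use assms in \<open>auto simp: * [symmetric] intro!: less_imp_le Gamma_real_pos\<close>)
  thus "integrable lborel (\<lambda>t. indicator {0..} t * t powr (a - 1) / exp t :: real)"
    and "(\<integral>t. indicator {0..} t * t powr (a - 1) / exp t \<partial>lborel) = (Gamma a :: real)"
    by (auto simp: has_bochner_integral_iff)
qed

lemma powr_quotient_bounds:
  fixes t h :: real
  assumes "0 < t" "0 < h" "h \<le> 1"
  shows "ln t \<le> (t powr h - 1) / h" "(t powr h - 1) / h \<le> t - 1"
proof -
  have "1 + h * ln t \<le> t powr h"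
    using exp_ge_add_one_self[of "h * ln t"] assms by (simp add: powr_def)
  thus "ln t \<le> (t powr h - 1) / h" using assms by (simp add: field_simps)
  have "exp ((1 - h) *\<^sub>R 0 + h *\<^sub>R ln t) \<le> (1 - h) * exp 0 + h * exp (ln t)"
    by (rule convex_onD[OF exp_convex]) (use assms in auto)
  hence "t powr h \<le> 1 + h * (t - 1)" using assms by (simp add: powr_def algebra_simps)
  thus "(t powr h - 1) / h \<le> t - 1" using assms by (simp add: field_simps)
qed

lemma abs_ln_bound:
  fixes t :: real
  assumes "0 < t"
  shows "\<bar>ln t\<bar> \<le> 2 * t powr (-1/2) + t"
proof (cases "t \<ge> 1")
  case True
  have "ln t \<le> t" using ln_le_minus_one[of t] assms by simp
  thus ?thesis using True by (simp add: add_increasing)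
next
  case False
  have "ln (t powr (-1/2)) \<le> t powr (-1/2)"
    using ln_le_minus_one[of "t powr (-1/2)"] assms by simp
  hence "- ln t \<le> 2 * t powr (-1/2)" using assms by (simp add: ln_powr)
  thus ?thesis using False assms by simp
qed

lemma euler_mascheroni_integral:
  "integrable lborel (\<lambda>t. indicator {0..} t * (exp (- t) * ln t) :: real)"
  "- (\<integral>t. indicator {0..} t * (exp (- t) * ln t) \<partial>lborel) = (euler_mascheroni :: real)"
proof -
  define h :: "nat \<Rightarrow> real" where "h n = 1 / real (Suc n)" for n
  have h: "0 < h n" "h n \<le> 1" for n by (auto simp: h_def)
  have h0: "h \<longlonglongrightarrow> 0" unfolding h_def
    using LIMSEQ_inverse_real_of_nat by (simp add: inverse_eq_divide)
  define s where "s n t = (indicator {0..} t * t powr (1 + h n - 1) / exp t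
        - indicator {0..} t * t powr (1 - 1) / exp t) / h n" for n and t :: real
  define w where "w t = 2 * (indicator {0..} t * t powr (1/2 - 1) / exp t)
        + 2 * (indicator {0..} t * t powr (2 - 1) / exp t)
        + indicator {0..} t * t powr (1 - 1) / exp t" for t :: real
  define g where "g t = indicator {0..} t * (exp (- t) * ln t)" for t :: real
  have w_int: "integrable lborel w" unfolding w_def
    by (intro Bochner_Integration.integrable_add integrable_mult_right integrable_Gamma) auto
  have w_ge: "w t \<ge> 0" for t by (auto simp: w_def indicator_def)
  have s_eq: "s n t = indicator {0..} t * (exp (- t) * ((t powr h n - 1) / h n))" if "t \<noteq> 0" for n t
    using that by (auto simp: s_def indicator_def exp_minus field_simps)
  have s_int: "(\<integral>t. s n t \<partial>lborel) = (Gamma (1 + h n) - Gamma 1) / h n" for n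
    unfolding s_def using h[of n] integrable_Gamma[of "1 + h n"] integrable_Gamma[of 1]
    by simp
  have bnd: "norm (s n t) \<le> w t" if "t \<noteq> 0" for n t
  proof (cases "t > 0")
    case True
    let ?q = "(t powr h n - 1) / h n"
    have "\<bar>?q\<bar> \<le> \<bar>ln t\<bar> + (t + 1)"
      using powr_quotient_bounds[OF True h(1)[of n] h(2)[of n]] True by linarith
    also have "\<dots> \<le> 2 * t powr (-1/2) + 2 * t + 1" using abs_ln_bound[OF True] by simp
    finally have q: "\<bar>?q\<bar> \<le> 2 * t powr (-1/2) + 2 * t + 1" .
    have "norm (s n t) = exp (- t) * \<bar>?q\<bar>" using True by (simp add: s_eq abs_mult)
    also have "\<dots> \<le> exp (- t) * (2 * t powr (-1/2) + 2 * t + 1)" by (rule mult_left_mono[OF q]) simp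
    also have "\<dots> = w t" using True by (simp add: w_def exp_minus field_simps)
    finally show ?thesis .
  next
    case False
    thus ?thesis using that w_ge[of t] by (simp add: s_eq)
  qed
  have lim: "(\<lambda>n. s n t) \<longlonglongrightarrow> g t" if "t \<noteq> 0" for t
  proof (cases "t > 0")
    case True
    have "((\<lambda>x. t powr x) has_real_derivative ln t) (at 0)"
      using True by (auto intro!: derivative_eq_intros)
    hence "((\<lambda>x. (t powr x - 1) / x) \<longlongrightarrow> ln t) (at 0)"
      using True by (simp add: DERIV_def)
    hence "(\<lambda>n. (t powr h n - 1) / h n) \<longlonglongrightarrow> ln t"
      by (rule filterlim_compose) (use h h0 in \<open>auto simp: filterlim_at intro!: always_eventually less_imp_neq[symmetric]\<close>)
    thus ?thesis using that unfolding s_eq[OF that] g_def by (intro tendsto_intros)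
  next
    case False
    thus ?thesis using that by (simp add: s_eq g_def)
  qed
  have ae: "AE t in lborel. t \<noteq> (0::real)" by (rule AE_lborel_singleton)
  have m1: "g \<in> borel_measurable lborel" unfolding g_def by measurable
  have m2: "s n \<in> borel_measurable lborel" for n unfolding s_def by measurable
  have a1: "AE t in lborel. (\<lambda>n. s n t) \<longlonglongrightarrow> g t"
    using ae by eventually_elim (rule lim)
  have a2: "AE t in lborel. norm (s n t) \<le> w t" for n
    using ae by eventually_elim (rule bnd)
  show "integrable lborel (\<lambda>t. indicator {0..} t * (exp (- t) * ln t) :: real)"
    using integrable_dominated_convergence[OF m1 m2 w_int a1 a2] by (simp add: g_def)
  have L1: "(\<lambda>n. (Gamma (1 + h n) - Gamma 1) / h n) \<longlonglongrightarrow> (\<integral>t. g t \<partial>lborel)"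
    using integral_dominated_convergence[OF m1 m2 w_int a1 a2] by (simp add: s_int)
  have "(Gamma has_real_derivative (Gamma 1 * Digamma 1)) (at 1)"
    by (rule has_field_derivative_Gamma) auto
  hence "((\<lambda>x::real. (Gamma (1 + x) - Gamma 1) / x) \<longlongrightarrow> - euler_mascheroni) (at 0)"
    by (simp add: DERIV_def)
  hence "(\<lambda>n. (Gamma (1 + h n) - Gamma 1) / h n) \<longlonglongrightarrow> - euler_mascheroni"
    by (rule filterlim_compose) (use h h0 in \<open>auto simp: filterlim_at intro!: always_eventually less_imp_neq[symmetric]\<close>)
  from LIMSEQ_unique[OF L1 this]
  show "- (\<integral>t. indicator {0..} t * (exp (- t) * ln t) \<partial>lborel) = (euler_mascheroni :: real)"
    by (simp add: g_def)
qed

text \<open>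
  Powers with a positive exponent and the logarithm, with extended values:
  \<open>\<infinity>\<close> to a positive power is \<open>\<infinity>\<close>, and \<open>log 0 = -\<infinity>\<close>.
\<close>

definition ennpowr :: "ennreal \<Rightarrow> real \<Rightarrow> ennreal" where
  "ennpowr t a = (if t = \<infinity> then \<infinity> else ennreal (enn2real t powr a))"

definition elog :: "real \<Rightarrow> ereal" where
  "elog r = (if r = 0 then - \<infinity> else ereal (ln r))"

definition G_fun :: "ereal \<Rightarrow> ennreal" where
  "G_fun t = (if t < 1 then 0 else if t = \<infinity> then \<infinity>
              else ennreal (real_of_ereal t * ln (real_of_ereal t)))"

definition I_avg :: "('a::euclidean_space \<Rightarrow> real) \<Rightarrow> 'a \<Rightarrow> real \<Rightarrow> ennreal" where
  "I_avg f x r = (\<integral>\<^sup>+y\<in>cball x r. ennreal (f y) \<partial>lborel)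
                 / ennreal (r ^ DIM('a) * unit_ball_vol (real DIM('a)))"

definition M_max :: "('a::euclidean_space \<Rightarrow> real) \<Rightarrow> 'a \<Rightarrow> real \<Rightarrow> ennreal" where
  "M_max f x R = (SUP r\<in>{0<..R}. I_avg f x r)"

definition m_min :: "('a::euclidean_space \<Rightarrow> real) \<Rightarrow> 'a \<Rightarrow> real \<Rightarrow> ennreal" where
  "m_min f x R = (INF r\<in>{0<..R}. I_avg f x r)"

definition K_fun :: "('a::euclidean_space \<Rightarrow> real) \<Rightarrow> real \<Rightarrow> ennreal" where
  "K_fun f e = (\<integral>\<^sup>+x. ennpowr (\<integral>\<^sup>+y. G_fun \<bar>elog (dist x y)\<bar> * ennreal (f y) \<partial>lborel) (1 + e)
                     * ennreal (f x) \<partial>lborel)"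

definition Q_fun :: "('a::euclidean_space \<Rightarrow> real) \<Rightarrow> real \<Rightarrow> real \<Rightarrow> ennreal" where
  "Q_fun f e R = (\<integral>\<^sup>+x. ennpowr (M_max f x R) e * ennreal (f x) \<partial>lborel)"

text \<open>
  In \<^typ>\<open>ennreal\<close> we have \<open>inverse 0 = \<infinity>\<close>, and \<open>\<infinity> * 0 = 0\<close>, so that only the points with
  \<open>f x > 0\<close> contribute to the integrals in \<open>x\<close>.
\<close>

definition T_fun :: "('a::euclidean_space \<Rightarrow> real) \<Rightarrow> real \<Rightarrow> real \<Rightarrow> ennreal" where
  "T_fun f e R = (\<integral>\<^sup>+x. inverse (ennpowr (m_min f x R) e) * ennreal (f x) \<partial>lborel)"

end

theory Submission
  imports Defs
begin

text \<open>
  Put \<open>n = N - 1\<close> and \<open>F x r = P (dist x \<xi> \<le> r)\<close>. By symmetry \<open>E H\<^sub>N - \<gamma>\<close> is the expectation of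
  \<open>L = ln (n V\<^sub>d \<rho>\<^sub>1^d)\<close>, and \<open>P (L > s) = S n s = \<integral> (1 - F x (r n s))^n f x dx\<close>, where \<open>r n s\<close> is
  determined by \<open>n V\<^sub>d (r n s)^d = exp s\<close>. By the layer cake formula
  \<open>E L = \<integral> (S n s - [s < 0]) ds\<close>, and one passes to the limit under this integral over \<open>s\<close>.

  Pointwise, \<open>S n s\<close> tends to \<open>\<integral> exp (- exp s * f x) f x dx\<close>, since ball averages of \<open>f\<close> converge
  to \<open>f\<close> in \<open>L\<^sup>1\<close> and hence almost everywhere along subsequences. The limit is the survival function
  of \<open>ln U - ln (f \<xi>)\<close> with \<open>U\<close> standard exponential and independent of \<open>\<xi>\<close>, whose expectation is
  \<open>- \<gamma> + H f\<close>.

  For \<open>s < 0\<close>, Bernoulli's inequality and \<open>Q < \<infinity>\<close> bound \<open>1 - S n s\<close> by a multiple of \<open>exp (\<epsilon>\<^sub>1 s)\<close>;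
  for \<open>s \<ge> 0\<close> with \<open>r n s \<le> R\<^sub>2\<close>, the inequality \<open>1 - p \<le> exp (- p)\<close> and \<open>T < \<infinity>\<close> bound \<open>S n s\<close> by a
  multiple of \<open>exp (- \<epsilon>\<^sub>2 s)\<close>. The part with \<open>r n s > R\<^sub>2\<close> becomes, after the substitution \<open>r n s = exp t\<close>,
  an integral that decreases in \<open>n\<close> and is finite for \<open>n = 1\<close>, where it is controlled by the first moment
  of \<open>ln (dist X\<^sub>1 X\<^sub>2)\<close>, hence by \<open>K\<close>; so it tends to \<open>0\<close> by dominated convergence.
\<close>

subsection \<open>Survival functions and elementary bounds\<close>

text \<open>Integrating [s < L] - [s < 0] over s gives L, so the claim is Fubini's theorem. For
  fixed s this difference has constant sign, so the integral of its norm over \<open>M\<close> is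
  the absolute value of the integrand in \<open>int\<close>, and integrability on the product
  follows.\<close>

lemma (in prob_space) layer_cake:
  fixes L :: "'a \<Rightarrow> real"
  assumes L [measurable]: "L \<in> borel_measurable M"
    and int: "integrable lborel (\<lambda>s. prob {\<omega> \<in> space M. s < L \<omega>} - of_bool (s < 0))"
  shows "integrable M L"
    and "expectation L = (\<integral>s. prob {\<omega> \<in> space M. s < L \<omega>} - of_bool (s < 0) \<partial>lborel)"
proof -
  interpret pair_sigma_finite lborel M ..
  define h where "h = (\<lambda>(s, \<omega>). (if s < L \<omega> then 1 else 0) - (if s < 0 then 1 else 0 :: real))"
  have h_meas [measurable]: "h \<in> borel_measurable (lborel \<Otimes>\<^sub>M M)"
    unfolding h_def by measurable
  have P: "(\<integral>\<omega>. (if s < L \<omega> then 1 else 0) \<partial>M) = prob {\<omega> \<in> space M. s < L \<omega>}" for s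
  proof -
    have "(\<integral>\<omega>. (if s < L \<omega> then 1 else 0) \<partial>M) = (\<integral>\<omega>. indicator {\<omega> \<in> space M. s < L \<omega>} \<omega> \<partial>M :: real)"
      by (intro Bochner_Integration.integral_cong) (auto simp: indicator_def)
    thus ?thesis by simp
  qed
  have int_s: "integrable M (\<lambda>\<omega>. h (s, \<omega>))" for s
    by (rule integrable_const_bound[where B=1]) (auto simp: h_def)
  have int_ind: "integrable M (\<lambda>\<omega>. if s < L \<omega> then 1 else 0 :: real)" for s
    by (rule integrable_const_bound[where B=1]) auto
  have h_s: "(\<integral>\<omega>. h (s, \<omega>) \<partial>M) = prob {\<omega> \<in> space M. s < L \<omega>} - of_bool (s < 0)" for s
    using int_ind[of s] by (simp add: h_def P prob_space)
  have norm_s: "(\<integral>\<omega>. norm (h (s, \<omega>)) \<partial>M)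
      = norm (prob {\<omega> \<in> space M. s < L \<omega>} - of_bool (s < 0))" for s
  proof (cases "s < 0")
    case True
    have "(\<integral>\<omega>. norm (h (s, \<omega>)) \<partial>M) = (\<integral>\<omega>. - h (s, \<omega>) \<partial>M)"
      using True by (intro Bochner_Integration.integral_cong) (auto simp: h_def)
    thus ?thesis using True h_s[of s] by simp
  next
    case False
    have "(\<integral>\<omega>. norm (h (s, \<omega>)) \<partial>M) = (\<integral>\<omega>. h (s, \<omega>) \<partial>M)"
      using False by (intro Bochner_Integration.integral_cong) (auto simp: h_def)
    thus ?thesis using False h_s[of s] by simp
  qed
  have int_h: "integrable (lborel \<Otimes>\<^sub>M M) h"
    using integrable_norm[OF int] by (intro Fubini_integrable) (simp_all only: norm_s int_s h_meas simp_thms eventually_True)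
  have L_eq: "(\<integral>s. h (s, \<omega>) \<partial>lborel) = L \<omega>" for \<omega>
  proof -
    have "(\<integral>s. h (s, \<omega>) \<partial>lborel)
        = (if 0 \<le> L \<omega> then \<integral>s. indicator {0..<L \<omega>} s \<partial>lborel
           else \<integral>s. - indicator {L \<omega>..<0} s \<partial>lborel :: real)"
      by (auto intro!: Bochner_Integration.integral_cong simp: h_def indicator_def
               simp del: Bochner_Integration.integral_minus)
    also have "\<dots> = L \<omega>" by simp
    finally show ?thesis .
  qed
  show "integrable M L"
    using integrable_snd[of "\<lambda>s \<omega>. h (s, \<omega>)"] int_h by (simp add: L_eq)
  show "expectation L = (\<integral>s. prob {\<omega> \<in> space M. s < L \<omega>} - of_bool (s < 0) \<partial>lborel)"
    using Fubini_integral[of "\<lambda>s \<omega>. h (s, \<omega>)"] int_h by (simp add: L_eq h_s)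
qed

text \<open>Needed because convergence in the mean gives almost everywhere convergence only along
  subsequences.\<close>

lemma tendsto_subseqI:
  fixes X :: "nat \<Rightarrow> 'b::metric_space"
  assumes "\<And>r :: nat \<Rightarrow> nat. strict_mono r \<Longrightarrow> \<exists>s. strict_mono s \<and> (\<lambda>n. X (r (s n))) \<longlonglongrightarrow> l"
  shows "X \<longlonglongrightarrow> l"
proof (rule ccontr)
  assume "\<not> X \<longlonglongrightarrow> l"
  then obtain e where e: "e > 0" "\<not> (\<forall>\<^sub>F n in sequentially. dist (X n) l < e)"
    unfolding tendsto_iff by blast
  hence "infinite {n. dist (X n) l \<ge> e}"
    by (simp add: eventually_sequentially infinite_nat_iff_unbounded_le not_less)
  then obtain r :: "nat \<Rightarrow> nat" where r: "strict_mono r" "\<And>n. dist (X (r n)) l \<ge> e"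
    using infinite_enumerate[of "{n. dist (X n) l \<ge> e}"] by blast
  obtain s where "(\<lambda>n. X (r (s n))) \<longlonglongrightarrow> l" using assms[OF r(1)] by blast
  hence "\<forall>\<^sub>F n in sequentially. dist (X (r (s n))) l < e" using e(1) by (rule tendstoD)
  hence "\<forall>\<^sub>F n in sequentially. False"
    by eventually_elim (use r(2) in \<open>simp add: not_less[symmetric]\<close>)
  thus False by simp
qed

text \<open>As k tends to infinity, convergence of k p forces p to 0. Then ln (1 - p) = - p +
  O(p^2), and k p^2 = (k p) p tends to 0.\<close>

lemma tendsto_one_minus_power:
  fixes p :: "nat \<Rightarrow> real" and k :: "nat \<Rightarrow> nat"
  assumes k: "filterlim k at_top sequentially" and p: "(\<lambda>j. real (k j) * p j) \<longlonglongrightarrow> a"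
  shows "(\<lambda>j. (1 - p j) ^ k j) \<longlonglongrightarrow> exp (- a)"
proof -
  have k': "filterlim (\<lambda>j. real (k j)) at_top sequentially"
    by (rule filterlim_compose[OF filterlim_real_sequentially k])
  have k0: "\<forall>\<^sub>F j in sequentially. real (k j) > 0"
    using k' unfolding filterlim_at_top_dense by blast
  have "(\<lambda>j. (real (k j) * p j) * inverse (real (k j))) \<longlonglongrightarrow> a * 0"
    by (intro tendsto_mult p tendsto_inverse_0_at_top k')
  moreover have "\<forall>\<^sub>F j in sequentially. (real (k j) * p j) * inverse (real (k j)) = p j"
    using k0 by eventually_elim simp
  ultimately have p0: "p \<longlonglongrightarrow> 0" by (simp add: Lim_transform_eventually)
  \<comment> \<open>In this range the quadratic remainder bound for the logarithm applies and 1 - p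
    is positive.\<close>
  have small: "\<forall>\<^sub>F j in sequentially. \<bar>p j\<bar> < 1/2"
    using tendstoD[OF p0, of "1/2"] by simp
  have "(\<lambda>j. real (k j) * (ln (1 + - p j) - - p j)) \<longlonglongrightarrow> 0"
  proof (rule Lim_null_comparison)
    show "\<forall>\<^sub>F j in sequentially. norm (real (k j) * (ln (1 + - p j) - - p j)) \<le> 2 * \<bar>(real (k j) * p j) * p j\<bar>"
      using small
    proof eventually_elim
      case (elim j)
      have "\<bar>ln (1 + - p j) - - p j\<bar> \<le> 2 * (- p j)\<^sup>2"
        by (rule abs_ln_one_plus_x_minus_x_bound) (use elim in auto)
      hence "real (k j) * \<bar>ln (1 + - p j) - - p j\<bar> \<le> real (k j) * (2 * (- p j)\<^sup>2)"
        by (rule mult_left_mono) auto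
      thus ?case by (simp add: abs_mult power2_eq_square)
    qed
    have "(\<lambda>j. 2 * \<bar>(real (k j) * p j) * p j\<bar>) \<longlonglongrightarrow> 2 * \<bar>a * 0\<bar>"
      by (intro tendsto_intros p p0)
    thus "(\<lambda>j. 2 * \<bar>(real (k j) * p j) * p j\<bar>) \<longlonglongrightarrow> 0" by simp
  qed
  hence "(\<lambda>j. exp (real (k j) * (ln (1 + - p j) - - p j) - real (k j) * p j)) \<longlonglongrightarrow> exp (0 - a)"
    by (intro tendsto_intros p)
  hence "(\<lambda>j. exp (real (k j) * ln (1 - p j))) \<longlonglongrightarrow> exp (- a)"
    by (simp add: algebra_simps)
  moreover have "\<forall>\<^sub>F j in sequentially. exp (real (k j) * ln (1 - p j)) = (1 - p j) ^ k j"
    using small by eventually_elim (simp add: exp_of_nat_mult)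
  ultimately show ?thesis by (rule Lim_transform_eventually)
qed

text \<open>If n p \<le> 1, Bernoulli's inequality gives the bound n p, which is at most its e-th
  power because e \<le> 1. Otherwise the right side is at least 1.\<close>

lemma one_minus_power_le_powr:
  fixes p e :: real
  assumes p: "0 \<le> p" "p \<le> 1" and e: "0 < e" "e \<le> 1"
  shows "1 - (1 - p) ^ n \<le> (real n * p) powr e"
proof (cases "real n * p \<le> 1")
  case True
  have "1 + real n * (- p) \<le> (1 + - p) ^ n"
    by (rule Bernoulli_inequality) (use p in auto)
  hence "1 - (1 - p) ^ n \<le> real n * p" by simp
  also have "real n * p = (real n * p) powr 1" using p by simp
  also have "\<dots> \<le> (real n * p) powr e"
    using True p e by (intro powr_mono') auto
  finally show ?thesis .
next
  case False
  have "1 - (1 - p) ^ n \<le> 1" using p by simp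
  also have "\<dots> \<le> (real n * p) powr e" using False e by (intro ge_one_powr_ge_zero) auto
  finally show ?thesis .
qed

text \<open>With y = n p the left side is at most exp (- y). Exponentiating e ln (y / e) \<le> y,
  where e is the given exponent, bounds exp (- y) by e^e y^(-e).\<close>

lemma one_minus_power_le_powr_uminus:
  fixes p e :: real
  assumes p: "0 < p" "p \<le> 1" and e: "0 < e" and n: "n > 0"
  shows "(1 - p) ^ n \<le> e powr e * (real n * p) powr (- e)"
proof -
  define y where "y = real n * p"
  have y: "y > 0" using p n by (simp add: y_def)
  have "(1 - p) ^ n \<le> exp (- p) ^ n"
    using p exp_ge_add_one_self[of "- p"] by (intro power_mono) auto
  also have "\<dots> = exp (- y)" by (simp add: exp_of_nat_mult[symmetric] y_def)
  also have "\<dots> \<le> e powr e * y powr (- e)"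
  proof -
    have "ln (y / e) \<le> y / e" using ln_le_minus_one[of "y / e"] y e by simp
    hence "e * ln (y / e) \<le> y" using e by (simp add: field_simps)
    hence "e * ln y - e * ln e \<le> y" using y e by (simp add: ln_div algebra_simps)
    hence "exp (- y) \<le> exp (e * ln e - e * ln y)" by simp
    also have "\<dots> = e powr e * y powr (- e)"
      using y e by (simp add: powr_def exp_add[symmetric])
    finally show ?thesis .
  qed
  finally show ?thesis by (simp add: y_def)
qed

section \<open>Powers with extended values and further auxiliary facts\<close>

lemma ennpowr_ennreal: "0 \<le> t \<Longrightarrow> ennpowr (ennreal t) a = ennreal (t powr a)"
  by (simp add: ennpowr_def)

lemma ennpowr_mono: "0 < a \<Longrightarrow> s \<le> t \<Longrightarrow> ennpowr s a \<le> ennpowr t a"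
  by (cases s; cases t) (auto simp: ennpowr_def top_unique intro!: ennreal_leI powr_mono2)

text \<open>Serves to pass from the moment of order 1 + e in \<open>K_fun\<close> to a first
  moment.\<close>

lemma le_one_plus_ennpowr: "1 \<le> a \<Longrightarrow> t \<le> 1 + ennpowr t a"
proof (cases t)
  case (real r)
  assume a: "1 \<le> a"
  have "r \<le> 1 + r powr a"
  proof (cases "r \<le> 1")
    case False
    hence "r powr 1 \<le> r powr a" using a by (intro powr_mono) auto
    thus ?thesis using False by simp
  qed (simp add: add_increasing2)
  hence "ennreal r \<le> ennreal (1 + r powr a)" by (rule ennreal_leI)
  thus ?thesis using real by (simp add: ennpowr_ennreal)
qed (simp add: ennpowr_def)

text \<open>The integrand is \<open>exponential_density l\<close> divided by l.\<close>

lemma integrable_exp_uminus: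
  fixes l :: real assumes "l > 0"
  shows "integrable lborel (\<lambda>s. of_bool (0 \<le> s) * exp (- (l * s)))"
proof -
  interpret E: prob_space "density lborel (exponential_density l)"
    by (rule prob_space_exponential_density) fact
  have "integrable (density lborel (\<lambda>x. ennreal (exponential_density l x))) (\<lambda>_. 1 :: real)"
    by simp
  hence "integrable lborel (exponential_density l)"
    using assms by (subst (asm) integrable_density) (auto simp: exponential_density_nonneg)
  hence "integrable lborel (\<lambda>s. exponential_density l s / l)" by simp
  also have "(\<lambda>s. exponential_density l s / l) = (\<lambda>s. of_bool (0 \<le> s) * exp (- (l * s)))"
    using assms by (auto simp: exponential_density_def fun_eq_iff mult.commute)
  finally show ?thesis .
qed

lemma le_imp_inverse_le_ennreal:
  fixes s t :: ennreal
  assumes "s \<le> t"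
  shows "inverse t \<le> inverse s"
proof (cases s; cases t)
  fix a b assume *: "s = ennreal a" "t = ennreal b" "0 \<le> a" "0 \<le> b"
  show ?thesis
  proof (cases "a = 0")
    case False
    thus ?thesis using * assms by (simp add: inverse_ennreal ennreal_leI)
  qed (use * in simp)
qed (use assms in \<open>simp_all add: top_unique\<close>)

lemma unit_ball_vol_neq_0 [simp]: "unit_ball_vol (real n) \<noteq> 0"
  by (metis less_irrefl of_nat_0_le_iff unit_ball_vol_pos)

lemma less_nn_dist_iff:
  assumes "i \<in> {1..N}" "2 \<le> N"
  shows "r < nn_dist N x i \<longleftrightarrow> (\<forall>j \<in> {1..N} - {i}. r < dist (x i) (x j))"
proof -
  \<comment> \<open>A second index exists because N \<ge> 2, so \<open>Min\<close> is taken over a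
    nonempty set.\<close>
  have "(if i = 1 then 2 else 1) \<in> {1..N} - {i}" using assms by auto
  hence "{1..N} - {i} \<noteq> {}" by blast
  thus ?thesis unfolding nn_dist_def by (subst Min_gr_iff) auto
qed

subsection \<open>Convergence of ball averages in the mean\<close>

text \<open>For r > 0 this is, as a function of y, the density of the uniform distribution on the
  closed ball of radius r around x.\<close>

definition ball_kernel :: "real \<Rightarrow> 'a::euclidean_space \<Rightarrow> 'a \<Rightarrow> ennreal" where
  "ball_kernel r x y = ennreal (of_bool (dist x y \<le> r) / (unit_ball_vol (real DIM('a)) * r ^ DIM('a)))"

text \<open>For r > 0 this dominates the mean distance between an integrable g and its averages over
  balls of radius r. Extended values avoid side conditions of integrability.\<close>

definition mean_osc :: "real \<Rightarrow> ('a::euclidean_space \<Rightarrow> real) \<Rightarrow> ennreal" where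
  "mean_osc r g = (\<integral>\<^sup>+x. \<integral>\<^sup>+y. ball_kernel r x y * ennreal \<bar>g x - g y\<bar> \<partial>lborel \<partial>lborel)"

lemma ball_kernel_sym: "ball_kernel r x y = ball_kernel r y x"
  by (simp add: ball_kernel_def dist_commute)

lemma ball_kernel_measurable [measurable]:
  "f \<in> borel_measurable M \<Longrightarrow> g \<in> borel_measurable M \<Longrightarrow> (\<lambda>z. ball_kernel r (f z) (g z :: 'a::euclidean_space)) \<in> borel_measurable M"
proof -
  define c where "c = unit_ball_vol (real DIM('a)) * r ^ DIM('a)"
  assume [measurable]: "f \<in> borel_measurable M" "g \<in> borel_measurable M"
  show "(\<lambda>z. ball_kernel r (f z) (g z)) \<in> borel_measurable M"
    unfolding ball_kernel_def c_def[symmetric] by measurable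
qed

lemma ball_kernel_integral:
  fixes x :: "'a::euclidean_space"
  assumes r: "r > 0"
  shows "(\<integral>\<^sup>+y. ball_kernel r x y \<partial>lborel) = 1"
proof -
  have V: "emeasure lborel (cball x r) = ennreal ((unit_ball_vol (real DIM('a)) * r ^ DIM('a)))"
          "(unit_ball_vol (real DIM('a)) * r ^ DIM('a)) > 0"
    using r by (simp_all add: emeasure_cball unit_ball_vol_pos)
  have "(\<integral>\<^sup>+y. ball_kernel r x y \<partial>lborel)
      = (\<integral>\<^sup>+y. ennreal (1 / (unit_ball_vol (real DIM('a)) * r ^ DIM('a))) * indicator (cball x r) y \<partial>lborel)"
    by (intro nn_integral_cong) (auto simp: ball_kernel_def indicator_def)
  also have "\<dots> = 1"
    using V r by (subst nn_integral_cmult_indicator) (auto simp: ennreal_mult'[symmetric] less_imp_neq[OF unit_ball_vol_pos, symmetric])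
  finally show ?thesis .
qed

lemma ball_kernel_integral_left:
  fixes g :: "'a::euclidean_space \<Rightarrow> ennreal"
  assumes [measurable]: "g \<in> borel_measurable borel"
    and "r > 0"
  shows "(\<integral>\<^sup>+x. \<integral>\<^sup>+y. ball_kernel r x y * g x \<partial>lborel \<partial>lborel) = (\<integral>\<^sup>+x. g x \<partial>lborel)"
  using assms by (simp add: nn_integral_multc ball_kernel_integral)

text \<open>The kernel is symmetric, so after exchanging the integrals it has total mass 1 in x as
  well.\<close>

lemma ball_kernel_integral_right:
  fixes g :: "'a::euclidean_space \<Rightarrow> ennreal"
  assumes [measurable]: "g \<in> borel_measurable borel"
    and "r > 0"
  shows "(\<integral>\<^sup>+x. \<integral>\<^sup>+y. ball_kernel r x y * g y \<partial>lborel \<partial>lborel) = (\<integral>\<^sup>+x. g x \<partial>lborel)"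
proof -
  have "(\<integral>\<^sup>+x. \<integral>\<^sup>+y. ball_kernel r x y * g y \<partial>lborel \<partial>lborel) = (\<integral>\<^sup>+y. \<integral>\<^sup>+x. ball_kernel r x y * g y \<partial>lborel \<partial>lborel)"
    by (rule lborel_pair.Fubini'[symmetric]) measurable
  also have "\<dots> = (\<integral>\<^sup>+y. g y \<partial>lborel)"
    using assms(2) by (subst ball_kernel_sym) (simp add: nn_integral_multc ball_kernel_integral)
  finally show ?thesis .
qed

text \<open>Triangle inequality through h x and h y. Each of the two error terms integrates to the
  distance of g and h in the mean, since the kernel has mass 1 in either variable.\<close>

lemma mean_osc_le_add:
  fixes g h :: "'a::euclidean_space \<Rightarrow> real"
  assumes [measurable]: "g \<in> borel_measurable borel" "h \<in> borel_measurable borel"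
    and r: "r > 0"
  shows "mean_osc r g \<le> mean_osc r h + 2 * (\<integral>\<^sup>+x. ennreal \<bar>g x - h x\<bar> \<partial>lborel)"
proof -
  have "mean_osc r g \<le> (\<integral>\<^sup>+x. \<integral>\<^sup>+y. ball_kernel r x y * ennreal \<bar>h x - h y\<bar>
      + (ball_kernel r x y * ennreal \<bar>g x - h x\<bar> + ball_kernel r x y * ennreal \<bar>g y - h y\<bar>) \<partial>lborel \<partial>lborel)"
    unfolding mean_osc_def
  proof (intro nn_integral_mono)
    fix x y
    have "ennreal \<bar>g x - g y\<bar> \<le> ennreal \<bar>h x - h y\<bar> + (ennreal \<bar>g x - h x\<bar> + ennreal \<bar>g y - h y\<bar>)"
      by (subst ennreal_plus[symmetric], simp, simp)+ (intro ennreal_leI, linarith)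
    hence "ball_kernel r x y * ennreal \<bar>g x - g y\<bar> \<le> ball_kernel r x y * (ennreal \<bar>h x - h y\<bar> + (ennreal \<bar>g x - h x\<bar> + ennreal \<bar>g y - h y\<bar>))"
      by (rule mult_left_mono) simp
    thus "ball_kernel r x y * ennreal \<bar>g x - g y\<bar> \<le> ball_kernel r x y * ennreal \<bar>h x - h y\<bar>
      + (ball_kernel r x y * ennreal \<bar>g x - h x\<bar> + ball_kernel r x y * ennreal \<bar>g y - h y\<bar>)"
      by (simp add: distrib_left)
  qed
  also have "\<dots> = mean_osc r h + 2 * (\<integral>\<^sup>+x. ennreal \<bar>g x - h x\<bar> \<partial>lborel)"
    using r by (simp add: nn_integral_add ball_kernel_integral_left ball_kernel_integral_right mean_osc_def mult_2)
  finally show ?thesis .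
qed

lemma mean_osc_mult:
  fixes g :: "'a::euclidean_space \<Rightarrow> real"
  assumes [measurable]: "g \<in> borel_measurable borel"
  shows "mean_osc r (\<lambda>x. g x * c) = ennreal \<bar>c\<bar> * mean_osc r g"
proof -
  have "\<bar>g x * c - g y * c\<bar> = \<bar>c\<bar> * \<bar>g x - g y\<bar>" for x y
    by (simp add: left_diff_distrib[symmetric] abs_mult)
  thus ?thesis
    unfolding mean_osc_def
    by (simp add: ennreal_mult' nn_integral_cmult[symmetric] ac_simps)
qed

text \<open>The indicators differ exactly when one point lies in U and the other outside, and by
  symmetry both cases contribute equally. What remains is supported on x in U, so that
  \<open>indicator U\<close> can dominate it.\<close>

lemma mean_osc_indicator:
  fixes U :: "'a::euclidean_space set"
  assumes [measurable]: "U \<in> sets borel"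
  shows "mean_osc r (indicator U) = 2 * (\<integral>\<^sup>+x. \<integral>\<^sup>+y. ball_kernel r x y * indicator (U \<times> - U) (x, y) \<partial>lborel \<partial>lborel)"
proof -
  have "mean_osc r (indicator U) = (\<integral>\<^sup>+x. \<integral>\<^sup>+y. ball_kernel r x y * indicator (U \<times> - U) (x, y)
      + ball_kernel r y x * indicator (U \<times> - U) (y, x) \<partial>lborel \<partial>lborel)"
    unfolding mean_osc_def
    by (intro nn_integral_cong) (auto simp: indicator_def ball_kernel_sym[of r])
  also have "\<dots> = (\<integral>\<^sup>+x. \<integral>\<^sup>+y. ball_kernel r x y * indicator (U \<times> - U) (x, y) \<partial>lborel \<partial>lborel)
     + (\<integral>\<^sup>+x. \<integral>\<^sup>+y. ball_kernel r y x * indicator (U \<times> - U) (y, x) \<partial>lborel \<partial>lborel)"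
    by (simp add: nn_integral_add)
  also have "(\<integral>\<^sup>+x. \<integral>\<^sup>+y. ball_kernel r y x * indicator (U \<times> - U) (y, x) \<partial>lborel \<partial>lborel)
      = (\<integral>\<^sup>+x. \<integral>\<^sup>+y. ball_kernel r x y * indicator (U \<times> - U) (x, y) \<partial>lborel \<partial>lborel)"
    by (rule lborel_pair.Fubini') measurable
  finally show ?thesis by (simp add: mult_2)
qed

lemma tendsto_ennreal_0I:
  fixes X :: "nat \<Rightarrow> ennreal"
  assumes "\<And>e::real. e > 0 \<Longrightarrow> \<forall>\<^sub>F n in sequentially. X n < ennreal e"
  shows "X \<longlonglongrightarrow> 0"
proof (rule order_tendstoI)
  fix a :: ennreal assume "0 < a"
  then obtain z where z: "0 < z" "z < a" using dense by blast
  hence "z = ennreal (enn2real z)" "enn2real z > 0"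
    by (auto simp: enn2real_positive_iff less_top[symmetric] dest: order.strict_trans2[OF _ top_greatest])
  thus "\<forall>\<^sub>F n in sequentially. X n < a"
    using assms[of "enn2real z"] z by (auto elim!: eventually_mono)
qed auto

text \<open>For x in U the inner integral vanishes once the ball around x fits into U, and finite
  volume makes \<open>indicator U\<close> an integrable bound.\<close>

lemma mean_osc_tendsto_open:
  fixes U :: "'a::euclidean_space set" and r :: "nat \<Rightarrow> real"
  assumes U: "open U" "emeasure lborel U < \<infinity>" and r: "\<And>n. r n > 0" "r \<longlonglongrightarrow> 0"
  shows "(\<lambda>n. mean_osc (r n) (indicator U)) \<longlonglongrightarrow> 0"
proof -
  have [measurable]: "U \<in> sets borel" using U by auto
  have k_le: "(\<integral>\<^sup>+y. ball_kernel (r n) x y * indicator (U \<times> - U) (x, y) \<partial>lborel) \<le> indicator U x" for n x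
  proof -
    have "(\<integral>\<^sup>+y. ball_kernel (r n) x y * indicator (U \<times> - U) (x, y) \<partial>lborel) \<le> (\<integral>\<^sup>+y. ball_kernel (r n) x y * indicator U x \<partial>lborel)"
      by (intro nn_integral_mono) (auto simp: indicator_def)
    also have "\<dots> = indicator U x"
      using r(1) by (simp add: nn_integral_multc ball_kernel_integral)
    finally show ?thesis .
  qed
  have "(\<lambda>n. \<integral>\<^sup>+x. \<integral>\<^sup>+y. ball_kernel (r n) x y * indicator (U \<times> - U) (x, y) \<partial>lborel \<partial>lborel)
     \<longlonglongrightarrow> (\<integral>\<^sup>+x. 0 \<partial>(lborel :: 'a measure))"
  proof (rule nn_integral_dominated_convergence[where w="indicator U"])
    show "AE x in lborel. (\<lambda>n. \<integral>\<^sup>+y. ball_kernel (r n) x y * indicator (U \<times> - U) (x, y) \<partial>lborel) \<longlonglongrightarrow> 0"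
    proof (rule AE_I2)
      fix x :: 'a
      show "(\<lambda>n. \<integral>\<^sup>+y. ball_kernel (r n) x y * indicator (U \<times> - U) (x, y) \<partial>lborel) \<longlonglongrightarrow> 0"
      proof (cases "x \<in> U")
        case True
        then obtain e where e: "e > 0" "\<And>y. dist x y < e \<Longrightarrow> y \<in> U"
          using U(1) by (auto simp: open_dist dist_commute)
        have "\<forall>\<^sub>F n in sequentially. r n < e" using order_tendstoD(2)[OF r(2)] e by simp
        hence "\<forall>\<^sub>F n in sequentially. 0 = (\<integral>\<^sup>+y. ball_kernel (r n) x y * indicator (U \<times> - U) (x, y) \<partial>lborel)"
        proof eventually_elim
          case (elim n)
          have "(\<integral>\<^sup>+y. ball_kernel (r n) x y * indicator (U \<times> - U) (x, y) \<partial>lborel) = (\<integral>\<^sup>+y. 0 \<partial>(lborel :: 'a measure))"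
            using e(2) elim by (intro nn_integral_cong) (force simp: indicator_def ball_kernel_def)
          thus ?case by simp
        qed
        thus ?thesis by (rule Lim_transform_eventually[OF tendsto_const])
      qed simp
    qed
    show "(\<integral>\<^sup>+x. indicator U x \<partial>lborel) < \<infinity>" using U by simp
  qed (use k_le in auto)
  hence "(\<lambda>n. 2 * (\<integral>\<^sup>+x. \<integral>\<^sup>+y. ball_kernel (r n) x y * indicator (U \<times> - U) (x, y) \<partial>lborel \<partial>lborel)) \<longlonglongrightarrow> 2 * 0"
    by (intro ennreal_tendsto_cmult) auto
  thus ?thesis by (simp add: mean_osc_indicator)
qed

text \<open>The class of functions with vanishing mean oscillation is closed under approximation in
  the mean, by \<open>mean_osc_le_add\<close>.\<close>

lemma mean_osc_tendsto_approx:
  fixes g :: "'a::euclidean_space \<Rightarrow> real" and r :: "nat \<Rightarrow> real"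
  assumes g: "g \<in> borel_measurable borel" and r: "\<And>n. r n > 0"
    and approx: "\<And>e::real. e > 0 \<Longrightarrow> \<exists>h \<in> borel_measurable borel.
        (\<lambda>n. mean_osc (r n) h) \<longlonglongrightarrow> 0 \<and> (\<integral>\<^sup>+x. ennreal \<bar>g x - h x\<bar> \<partial>lborel) \<le> ennreal e"
  shows "(\<lambda>n. mean_osc (r n) g) \<longlonglongrightarrow> 0"
proof (rule tendsto_ennreal_0I)
  fix e :: real assume e: "e > 0"
  \<comment> \<open>The error enters \<open>mean_osc_le_add\<close> with factor 2, so e/4 uses up
    half of e.\<close>
  obtain h where h: "h \<in> borel_measurable borel" "(\<lambda>n. mean_osc (r n) h) \<longlonglongrightarrow> 0"
      "(\<integral>\<^sup>+x. ennreal \<bar>g x - h x\<bar> \<partial>lborel) \<le> ennreal (e/4)"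
    using approx[of "e/4"] e by auto
  have "\<forall>\<^sub>F n in sequentially. mean_osc (r n) h < ennreal (e/2)"
    using order_tendstoD(2)[OF h(2), of "ennreal (e/2)"] e by simp
  thus "\<forall>\<^sub>F n in sequentially. mean_osc (r n) g < ennreal e"
  proof eventually_elim
    case (elim n)
    have "2 * (\<integral>\<^sup>+x. ennreal \<bar>g x - h x\<bar> \<partial>lborel) \<le> 2 * ennreal (e/4)"
      by (rule mult_left_mono[OF h(3)]) simp
    also have "\<dots> = ennreal (e/2)" using e ennreal_mult'[of 2 "e/4"] by simp
    finally have "mean_osc (r n) g \<le> mean_osc (r n) h + ennreal (e/2)"
      using mean_osc_le_add[OF g h(1) r] by (meson add_left_mono order_trans)
    also have "\<dots> < ennreal (e/2) + ennreal (e/2)"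
      using elim by (subst add.commute, subst ennreal_add_left_cancel_less) simp
    also have "\<dots> = ennreal e" using e by (simp add: ennreal_plus[symmetric])
    finally show ?case .
  qed
qed

text \<open>Outer regularity passes from open sets to Borel sets of finite measure. Sums and
  dominated limits then reach every integrable function.\<close>

lemma mean_osc_tendsto:
  fixes g :: "'a::euclidean_space \<Rightarrow> real" and r :: "nat \<Rightarrow> real"
  assumes g: "integrable lborel g" and r: "\<And>n. r n > 0" "r \<longlonglongrightarrow> 0"
  shows "(\<lambda>n. mean_osc (r n) g) \<longlonglongrightarrow> 0"
  using g
proof (induction g rule: integrable_induct)
  case (base A c)
  show ?case
  proof (rule mean_osc_tendsto_approx[OF _ r(1)])
    fix e :: real assume e: "e > 0"
    \<comment> \<open>The summand 1 keeps the quotient meaningful for c = 0.\<close>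
    have "e / (\<bar>c\<bar> + 1) > 0" using e by simp
    then obtain U where U: "open U" "A \<subseteq> U" "emeasure lborel (U - A) < e / (\<bar>c\<bar> + 1)"
      using outer_regular_lborel[of A "e / (\<bar>c\<bar> + 1)"] base by auto
    have [measurable]: "A \<in> sets borel" "U \<in> sets borel" using base U by auto
    have "emeasure lborel U \<le> emeasure lborel A + emeasure lborel (U - A)"
      using U(2) by (subst plus_emeasure) (auto intro!: emeasure_mono)
    also have "\<dots> < \<infinity>" using base U(3) by (auto simp: ennreal_add_eq_top less_top[symmetric])
    finally have fin: "emeasure lborel U < \<infinity>" .
    have "(\<lambda>n. ennreal \<bar>c\<bar> * mean_osc (r n) (indicator U :: 'a \<Rightarrow> real)) \<longlonglongrightarrow> ennreal \<bar>c\<bar> * 0"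
      by (intro ennreal_tendsto_cmult mean_osc_tendsto_open U fin r) auto
    hence 1: "(\<lambda>n. mean_osc (r n) (\<lambda>x::'a. indicator U x * c)) \<longlonglongrightarrow> 0"
      using mean_osc_mult[of "indicator U"] by simp
    have "(\<integral>\<^sup>+x. ennreal \<bar>indicator A x *\<^sub>R c - indicator U x * c\<bar> \<partial>lborel)
        = (\<integral>\<^sup>+x. ennreal \<bar>c\<bar> * indicator (U - A) x \<partial>lborel)"
      using U(2) by (intro nn_integral_cong) (auto simp: indicator_def)
    also have "\<dots> = ennreal \<bar>c\<bar> * emeasure lborel (U - A)" by (simp add: nn_integral_cmult_indicator)
    also have "\<dots> \<le> ennreal (\<bar>c\<bar> + 1) * ennreal (e / (\<bar>c\<bar> + 1))"
      using U(3) by (intro mult_mono) (auto intro!: ennreal_leI)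
    also have "\<dots> = ennreal e" by (subst ennreal_mult'[symmetric]) auto
    finally show "\<exists>h \<in> borel_measurable borel. (\<lambda>n. mean_osc (r n) h) \<longlonglongrightarrow> 0 \<and>
        (\<integral>\<^sup>+x. ennreal \<bar>indicator A x *\<^sub>R c - h x\<bar> \<partial>lborel) \<le> ennreal e"
      using 1 by (intro bexI[of _ "\<lambda>x. indicator U x * c"]) auto
  qed (use base in auto)
next
  case (add g h)
  have [measurable]: "g \<in> borel_measurable borel" "h \<in> borel_measurable borel"
    using add(1,2)[THEN borel_measurable_integrable] by auto
  have "mean_osc (r n) (\<lambda>x. g x + h x) \<le> mean_osc (r n) g + mean_osc (r n) h" for n
  proof -
    have "mean_osc (r n) (\<lambda>x. g x + h x) \<le> (\<integral>\<^sup>+x. \<integral>\<^sup>+y. ball_kernel (r n) x y * ennreal \<bar>g x - g y\<bar>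
        + ball_kernel (r n) x y * ennreal \<bar>h x - h y\<bar> \<partial>lborel \<partial>lborel)"
      unfolding mean_osc_def distrib_left[symmetric]
      by (intro nn_integral_mono mult_left_mono) (auto simp: ennreal_plus[symmetric] simp del: ennreal_plus intro!: ennreal_leI)
    also have "\<dots> = mean_osc (r n) g + mean_osc (r n) h"
      by (simp add: nn_integral_add mean_osc_def)
    finally show ?thesis .
  qed
  moreover have "(\<lambda>n. mean_osc (r n) g + mean_osc (r n) h) \<longlonglongrightarrow> 0 + 0"
    by (intro tendsto_add add)
  ultimately show ?case
    using tendsto_sandwich[of "\<lambda>_. 0" "\<lambda>n. mean_osc (r n) (\<lambda>x. g x + h x)" sequentially
        "\<lambda>n. mean_osc (r n) g + mean_osc (r n) h" 0] by simp
next
  case (lim g s)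
  have [measurable]: "g \<in> borel_measurable borel" "s i \<in> borel_measurable borel" for i
    using lim(1)[of i, THEN borel_measurable_integrable] lim(4)[THEN borel_measurable_integrable] by auto
  show ?case
  proof (rule mean_osc_tendsto_approx[OF _ r(1)])
    fix e :: real assume e: "e > 0"
    have "(\<lambda>i. \<integral>\<^sup>+x. ennreal \<bar>g x - s i x\<bar> \<partial>lborel) \<longlonglongrightarrow> (\<integral>\<^sup>+x. 0 \<partial>(lborel :: 'a measure))"
    \<comment> \<open>The induction rule supplies approximants of norm at most twice that of g,
      hence the factor 3.\<close>
    proof (rule nn_integral_dominated_convergence[where w="\<lambda>x. ennreal (3 * \<bar>g x\<bar>)"])
      show "AE x in lborel. ennreal \<bar>g x - s i x\<bar> \<le> ennreal (3 * \<bar>g x\<bar>)" for i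
      proof (rule AE_I2, rule ennreal_leI)
        fix x show "\<bar>g x - s i x\<bar> \<le> 3 * \<bar>g x\<bar>" using lim(3)[of x i] by simp
      qed
      show "AE x in lborel. (\<lambda>i. ennreal \<bar>g x - s i x\<bar>) \<longlonglongrightarrow> 0"
      proof (rule AE_I2)
        fix x
        have "(\<lambda>i. ennreal \<bar>g x - s i x\<bar>) \<longlonglongrightarrow> ennreal \<bar>g x - g x\<bar>"
          by (intro tendsto_intros lim) auto
        thus "(\<lambda>i. ennreal \<bar>g x - s i x\<bar>) \<longlonglongrightarrow> 0" by simp
      qed
      have "integrable lborel (\<lambda>x. 3 * \<bar>g x\<bar>)" using lim(4) by simp
      thus "(\<integral>\<^sup>+x. ennreal (3 * \<bar>g x\<bar>) \<partial>lborel) < \<infinity>"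
        unfolding integrable_iff_bounded by (simp add: abs_mult)
    qed auto
    hence L: "(\<lambda>i. \<integral>\<^sup>+x. ennreal \<bar>g x - s i x\<bar> \<partial>lborel) \<longlonglongrightarrow> 0" by simp
    have "\<forall>\<^sub>F i in sequentially. (\<integral>\<^sup>+x. ennreal \<bar>g x - s i x\<bar> \<partial>lborel) < ennreal e"
      by (rule order_tendstoD(2)[OF L]) (use e in simp)
    then obtain i where "(\<integral>\<^sup>+x. ennreal \<bar>g x - s i x\<bar> \<partial>lborel) < ennreal e"
      by (blast dest: eventually_happens'[OF sequentially_bot])
    thus "\<exists>h \<in> borel_measurable borel. (\<lambda>n. mean_osc (r n) h) \<longlonglongrightarrow> 0 \<and>
        (\<integral>\<^sup>+x. ennreal \<bar>g x - h x\<bar> \<partial>lborel) \<le> ennreal e"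
      using lim(5)[of i] by (intro bexI[of _ "s i"]) auto
  qed auto
qed

subsection \<open>Nearest neighbours in a sample from a density\<close>

locale density_prob =
  fixes f :: "'a::euclidean_space \<Rightarrow> real"
  assumes nonneg: "\<And>x. 0 \<le> f x"
    and f_measurable [measurable]: "f \<in> borel_measurable borel"
    and nn_integral_f: "(\<integral>\<^sup>+x. ennreal (f x) \<partial>lborel) = 1"
begin

definition D :: "'a measure" where
  "D = density lborel (\<lambda>x. ennreal (f x))"

definition ball_prob :: "'a \<Rightarrow> real \<Rightarrow> real" where
  "ball_prob x r = measure D (cball x r)"

definition ball_vol :: "real \<Rightarrow> real" where
  "ball_vol r = unit_ball_vol (real DIM('a)) * r ^ DIM('a)"

text \<open>The probability that \<open>n\<close> sample points are all farther than \<open>r\<close> from a further, independent one.\<close>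

definition surv :: "nat \<Rightarrow> real \<Rightarrow> real" where
  "surv n r = (\<integral>x. (1 - ball_prob x r) ^ n \<partial>D)"

section \<open>Elementary properties of ball and survival probabilities\<close>

lemma sets_D [measurable_cong, simp]: "sets D = sets borel"
  by (simp add: D_def)

lemma space_D [simp]: "space D = UNIV"
  by (simp add: D_def)

sublocale D: prob_space D
  by standard (simp add: D_def emeasure_density nn_integral_f)

lemma integrable_f: "integrable lborel f"
  by (rule integrableI_bounded) (simp_all add: nonneg nn_integral_f)

lemma AE_D: "AE x in lborel. P x \<Longrightarrow> AE x in D. P x"
  unfolding D_def by (subst AE_density) (auto elim!: eventually_mono)

lemma AE_D_pos: "AE x in D. 0 < f x"
  unfolding D_def by (subst AE_density) auto

lemma nn_integral_D:
  "g \<in> borel_measurable borel \<Longrightarrow> (\<integral>\<^sup>+x. g x \<partial>D) = (\<integral>\<^sup>+x. g x * ennreal (f x) \<partial>lborel)"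
  by (simp add: D_def nn_integral_density mult.commute)

lemma ball_prob_bounds [simp]: "0 \<le> ball_prob x r" "ball_prob x r \<le> 1"
  by (simp_all add: ball_prob_def)

lemma one_minus_ball_prob_power_bounds:
  "0 \<le> (1 - ball_prob x r) ^ n" "(1 - ball_prob x r) ^ n \<le> 1"
  using ball_prob_bounds[of x r] by (auto intro: power_le_one)

lemma ball_prob_mono: "r \<le> r' \<Longrightarrow> ball_prob x r \<le> ball_prob x r'"
  unfolding ball_prob_def by (intro D.finite_measure_mono) auto

text \<open>The integrand is jointly measurable in x and y, which yields the measurability of the
  ball probability in its centre.\<close>

lemma ball_prob_eq_nn_integral: "ennreal (ball_prob x r) = (\<integral>\<^sup>+y. of_bool (dist x y \<le> r) \<partial>D)"
proof -
  have "(\<integral>\<^sup>+y. of_bool (dist x y \<le> r) \<partial>D) = (\<integral>\<^sup>+y. indicator (cball x r) y \<partial>D)"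
    by (intro nn_integral_cong) (auto simp: indicator_def)
  thus ?thesis by (simp add: ball_prob_def D.emeasure_eq_measure)
qed

lemma ball_prob_measurable [measurable]: "(\<lambda>x. ball_prob x r) \<in> borel_measurable borel"
proof -
  have "(\<lambda>x. enn2real (\<integral>\<^sup>+y. of_bool (dist x y \<le> r) \<partial>D)) \<in> borel_measurable borel"
    by measurable
  thus ?thesis by (simp add: ball_prob_eq_nn_integral[symmetric])
qed

lemma integrable_surv: "integrable D (\<lambda>x. (1 - ball_prob x r) ^ n)"
  using one_minus_ball_prob_power_bounds
  by (intro D.integrable_const_bound[where B=1]) auto

lemma surv_nonneg: "0 \<le> surv n r"
  unfolding surv_def by (rule Bochner_Integration.integral_nonneg) (rule one_minus_ball_prob_power_bounds)

lemma ennreal_surv: "ennreal (surv n r) = (\<integral>\<^sup>+x. ennreal ((1 - ball_prob x r) ^ n) \<partial>D)"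
  unfolding surv_def
  by (rule nn_integral_eq_integral[symmetric, OF integrable_surv])
     (simp add: one_minus_ball_prob_power_bounds)

lemma ennreal_one_minus_surv:
  "ennreal (1 - surv n r) = (\<integral>\<^sup>+x. ennreal (1 - (1 - ball_prob x r) ^ n) \<partial>D)"
proof -
  have "(\<integral>x. 1 - (1 - ball_prob x r) ^ n \<partial>D) = 1 - surv n r"
    using integrable_surv[of r n] D.prob_space by (simp add: surv_def)
  moreover have "integrable D (\<lambda>x. 1 - (1 - ball_prob x r) ^ n)"
    using integrable_surv[of r n] by simp
  ultimately show ?thesis
    by (subst nn_integral_eq_integral) (auto simp: one_minus_ball_prob_power_bounds)
qed

lemma surv_le_1: "surv n r \<le> 1"
proof -
  have "surv n r \<le> (\<integral>x. 1 \<partial>D)"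
    unfolding surv_def using integrable_surv
    by (intro integral_mono) (auto simp: one_minus_ball_prob_power_bounds)
  thus ?thesis using D.prob_space by simp
qed

lemma surv_antimono: "r \<le> r' \<Longrightarrow> surv n r' \<le> surv n r"
  unfolding surv_def
  by (intro integral_mono integrable_surv power_mono) (auto intro: ball_prob_mono)

lemma surv_antimono_n: "n \<le> n' \<Longrightarrow> surv n' r \<le> surv n r"
  unfolding surv_def
  by (intro integral_mono integrable_surv power_decreasing) auto

lemma surv_measurable [measurable]: "surv n \<in> borel_measurable borel"
proof -
  have "(\<lambda>r. - surv n r) \<in> borel_measurable borel"
    by (rule borel_measurable_mono) (auto simp: mono_def surv_antimono)
  thus ?thesis by simp
qed

lemma ball_prob_0: "ball_prob x 0 = 0"
proof -
  have "emeasure D (cball x 0) = (\<integral>\<^sup>+y. ennreal (f y) * indicator {x} y \<partial>lborel)"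
    by (simp add: D_def emeasure_density)
  also have "\<dots> = (\<integral>\<^sup>+y. 0 \<partial>(lborel :: 'a measure))"
    using AE_lborel_singleton[of x] by (intro nn_integral_cong_AE, eventually_elim) (auto simp: indicator_def)
  finally show ?thesis by (simp add: ball_prob_def measure_def)
qed

text \<open>Single points carry no mass. This makes nearest neighbour distances positive almost
  surely, so that the default value \<open>ln 0 = 0\<close> does no harm.\<close>

lemma surv_0: "surv n 0 = 1"
  using D.prob_space by (simp add: surv_def ball_prob_0)

lemma ball_vol_pos: "0 < r \<Longrightarrow> 0 < ball_vol r"
  by (simp add: ball_vol_def)

text \<open>Once the coordinate i is fixed at y, the event says that all other coordinates avoid the
  ball around y. This is a product event, and integrating its probability over y gives
  \<open>surv\<close>.\<close>

lemma prob_all_far: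
  assumes J: "finite J" "i \<notin> J"
  shows "measure (PiM (insert i J) (\<lambda>_. D)) {x \<in> space (PiM (insert i J) (\<lambda>_. D)). \<forall>j\<in>J. r < dist (x i) (x j)}
     = surv (card J) r"
proof -
  interpret product_sigma_finite "\<lambda>_. D" ..
  let ?P = "PiM (insert i J) (\<lambda>_. D)"
  let ?A = "{x \<in> space ?P. \<forall>j\<in>J. r < dist (x i) (x j)}"
  note [simp] = J
  have [measurable]: "?A \<in> sets ?P" by measurable
  have "emeasure ?P ?A = (\<integral>\<^sup>+x. indicator ?A x \<partial>?P)" by simp
  also have "\<dots> = (\<integral>\<^sup>+y. \<integral>\<^sup>+x. indicator ?A (x(i := y)) \<partial>PiM J (\<lambda>_. D) \<partial>D)"
    by (rule product_nn_integral_insert_rev) auto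
  also have "\<dots> = (\<integral>\<^sup>+y. ennreal ((1 - ball_prob y r) ^ card J) \<partial>D)"
  proof (rule nn_integral_cong)
    fix y :: 'a
    let ?B = "Pi\<^sub>E J (\<lambda>_. UNIV - cball y r)"
    have [measurable]: "?B \<in> sets (PiM J (\<lambda>_. D))" by (intro sets_PiM_I_finite) auto
    have "(\<integral>\<^sup>+x. indicator ?A (x(i := y)) \<partial>PiM J (\<lambda>_. D)) = (\<integral>\<^sup>+x. indicator ?B x \<partial>PiM J (\<lambda>_. D))"
    proof (rule nn_integral_cong)
      fix x assume x: "x \<in> space (PiM J (\<lambda>_. D))"
      have "x(i := y) \<in> ?A \<longleftrightarrow> x \<in> ?B"
        using x by (auto simp: space_PiM PiE_iff extensional_def not_le)
      thus "(indicator ?A (x(i := y)) :: ennreal) = indicator ?B x" by (simp add: indicator_def)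
    qed
    also have "\<dots> = emeasure (PiM J (\<lambda>_. D)) ?B" by simp
    also have "\<dots> = (\<Prod>j\<in>J. emeasure D (UNIV - cball y r))" by (rule emeasure_PiM) auto
    also have "emeasure D (UNIV - cball y r) = ennreal (1 - ball_prob y r)"
      using D.prob_compl[of "cball y r"] by (simp add: D.emeasure_eq_measure ball_prob_def)
    also have "(\<Prod>j\<in>J. ennreal (1 - ball_prob y r)) = ennreal ((1 - ball_prob y r) ^ card J)"
      by (simp add: ennreal_power)
    finally show "(\<integral>\<^sup>+x. indicator ?A (x(i := y)) \<partial>PiM J (\<lambda>_. D)) = ennreal ((1 - ball_prob y r) ^ card J)" .
  qed
  finally show ?thesis by (simp add: measure_def ennreal_surv[symmetric] surv_nonneg)
qed

text \<open>The difference at x is the average of f y - f x over the ball, so its norm is at most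
  the inner integral of \<open>mean_osc\<close>.\<close>

lemma ball_prob_tendsto_L1:
  fixes r :: "nat \<Rightarrow> real"
  assumes r: "\<And>n. r n > 0" "r \<longlonglongrightarrow> 0"
  shows "integrable lborel (\<lambda>x. ball_prob x (r n) / ball_vol (r n) - f x)"
    and "(\<lambda>n. \<integral>x. norm (ball_prob x (r n) / ball_vol (r n) - f x) \<partial>lborel) \<longlonglongrightarrow> 0"
proof -
  have bound: "ennreal (norm (ball_prob x (r n) / ball_vol (r n) - f x))
      \<le> (\<integral>\<^sup>+y. ball_kernel (r n) x y * ennreal \<bar>f x - f y\<bar> \<partial>lborel)" for x n
  proof -
    define c where "c = ball_vol (r n)"
    have c: "c > 0" using r by (simp add: c_def ball_vol_pos)
    have cb: "emeasure lborel (cball x (r n)) = ennreal c"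
      using r(1)[of n] by (simp add: c_def ball_vol_def emeasure_cball)
    have i1: "integrable lborel (\<lambda>y. indicator (cball x (r n)) y * f y)"
      using integrable_mult_indicator[OF _ integrable_f, of "cball x (r n)"] by simp
    have i2: "integrable lborel (indicator (cball x (r n)) :: 'a \<Rightarrow> real)"
      using cb by (simp add: integrable_indicator_iff)
    have e1: "(\<integral>y. indicator (cball x (r n)) y * f y \<partial>lborel) = ball_prob x (r n)"
    proof -
      have "ennreal (ball_prob x (r n)) = (\<integral>\<^sup>+y. ennreal (indicator (cball x (r n)) y * f y) \<partial>lborel)"
        unfolding ball_prob_def D.emeasure_eq_measure[symmetric]
        by (simp add: D_def emeasure_density ennreal_mult'' nonneg mult.commute ennreal_indicator)
      also have "\<dots> = ennreal (\<integral>y. indicator (cball x (r n)) y * f y \<partial>lborel)"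
        using i1 by (intro nn_integral_eq_integral) (auto simp: nonneg)
      finally show ?thesis by (simp add: nonneg integral_nonneg_AE)
    qed
    have m: "measure lborel (cball x (r n)) = c"
      using cb c by (simp add: measure_def)
    have "ball_prob x (r n) / c - f x = (\<integral>y. (indicator (cball x (r n)) y * f y - indicator (cball x (r n)) y * f x) / c \<partial>lborel)"
      using i1 i2 c by (simp add: e1 m diff_divide_distrib)
    also have "norm \<dots> \<le> (\<integral>\<^sup>+y. norm ((indicator (cball x (r n)) y * f y - indicator (cball x (r n)) y * f x) / c) \<partial>lborel)"
      using i1 i2 by (intro integral_norm_bound_ennreal) auto
    also have "\<dots> = (\<integral>\<^sup>+y. ball_kernel (r n) x y * ennreal \<bar>f x - f y\<bar> \<partial>lborel)"
      using c by (intro nn_integral_cong)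
        (auto simp: ball_kernel_def ball_vol_def[symmetric] c_def[symmetric] indicator_def ennreal_mult''[symmetric] abs_minus_commute)
    finally show ?thesis by (simp add: c_def)
  qed
  have le: "(\<integral>\<^sup>+x. ennreal (norm (ball_prob x (r n) / ball_vol (r n) - f x)) \<partial>lborel) \<le> mean_osc (r n) f" for n
    unfolding mean_osc_def by (intro nn_integral_mono bound)
  have fin: "mean_osc (r n) f < \<infinity>" for n
  proof -
    \<comment> \<open>Comparison with the zero function, whose oscillation is 0, bounds the
      oscillation of f by twice its integral.\<close>
    have "mean_osc (r n) f \<le> mean_osc (r n) (\<lambda>_::'a. 0) + 2 * (\<integral>\<^sup>+x. ennreal \<bar>f x - 0\<bar> \<partial>lborel)"
      by (rule mean_osc_le_add) (use r in auto)
    also have "\<dots> = 2" using nn_integral_f by (simp add: mean_osc_def nonneg)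
    finally show ?thesis by (simp add: le_less_trans)
  qed
  have int: "integrable lborel (\<lambda>x. ball_prob x (r n) / ball_vol (r n) - f x)" for n
    using le[of n] fin[of n] by (intro integrableI_bounded) auto
  show "integrable lborel (\<lambda>x. ball_prob x (r n) / ball_vol (r n) - f x)" by (rule int)
  have "(\<lambda>n. ennreal (\<integral>x. norm (ball_prob x (r n) / ball_vol (r n) - f x) \<partial>lborel)) \<longlonglongrightarrow> ennreal 0"
  proof (rule tendsto_sandwich[where f="\<lambda>_. ennreal 0"])
    show "(\<lambda>n. mean_osc (r n) f) \<longlonglongrightarrow> ennreal 0"
      using mean_osc_tendsto[OF integrable_f r] by simp
    show "\<forall>\<^sub>F n in sequentially. ennreal (\<integral>x. norm (ball_prob x (r n) / ball_vol (r n) - f x) \<partial>lborel) \<le> mean_osc (r n) f"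
      using le int by (intro always_eventually allI) (subst nn_integral_eq_integral[symmetric], auto)
  qed auto
  thus "(\<lambda>n. \<integral>x. norm (ball_prob x (r n) / ball_vol (r n) - f x) \<partial>lborel) \<longlonglongrightarrow> 0"
    by (rule tendsto_ennrealD) simp_all
qed

text \<open>The radius whose ball has volume \<open>exp s / n\<close>, see \<open>ball_vol_nn_radius\<close> below.\<close>

definition nn_radius :: "nat \<Rightarrow> real \<Rightarrow> real" where
  "nn_radius n s = exp ((s - ln (real n * unit_ball_vol (real DIM('a)))) / real DIM('a))"

text \<open>For n \<ge> 1 this is the survival function of \<open>log_ratio (n + 1) i\<close>
  below.\<close>

definition scaled_surv :: "nat \<Rightarrow> real \<Rightarrow> real" where
  "scaled_surv n s = surv n (nn_radius n s)"

definition limit_surv :: "real \<Rightarrow> real" where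
  "limit_surv s = (\<integral>x. exp (- (exp s * f x)) \<partial>D)"

lemma nn_radius_pos [simp]: "0 < nn_radius n s"
  by (simp add: nn_radius_def)

lemma ball_vol_nn_radius: "n > 0 \<Longrightarrow> real n * ball_vol (nn_radius n s) = exp s"
proof -
  assume n: "n > 0"
  have "nn_radius n s ^ DIM('a) = exp (s - ln (real n * unit_ball_vol (real DIM('a))))"
    unfolding nn_radius_def by (simp add: exp_of_nat_mult[symmetric])
  also have "\<dots> = exp s / (real n * unit_ball_vol (real DIM('a)))"
    using n by (simp add: exp_diff)
  finally show ?thesis using n by (simp add: ball_vol_def)
qed

lemma nn_radius_tendsto: "(\<lambda>n. nn_radius n s) \<longlonglongrightarrow> 0"
proof -
  have V: "unit_ball_vol (real DIM('a)) > 0" by simp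
  have "filterlim (\<lambda>n. real n * unit_ball_vol (real DIM('a))) at_top sequentially"
    by (rule filterlim_at_top_mult_tendsto_pos[OF tendsto_const V filterlim_real_sequentially, THEN filterlim_cong[THEN iffD1, OF refl refl _, rotated 1]])
       (simp add: mult.commute)
  hence "filterlim (\<lambda>n. ln (real n * unit_ball_vol (real DIM('a)))) at_top sequentially"
    by (rule filterlim_compose[OF ln_at_top])
  hence "filterlim (\<lambda>n. - s + ln (real n * unit_ball_vol (real DIM('a)))) at_top sequentially"
    by (rule filterlim_tendsto_add_at_top[OF tendsto_const])
  hence "filterlim (\<lambda>n. (1 / real DIM('a)) * (- s + ln (real n * unit_ball_vol (real DIM('a))))) at_top sequentially"
    by (rule filterlim_tendsto_pos_mult_at_top[OF tendsto_const, rotated 1]) simp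
  hence "filterlim (\<lambda>n. - ((1 / real DIM('a)) * (- s + ln (real n * unit_ball_vol (real DIM('a)))))) at_bot sequentially"
    by (simp add: filterlim_uminus_at_top)
  from filterlim_compose[OF exp_at_bot this] show ?thesis
    unfolding nn_radius_def
    by (rule tendsto_cong[THEN iffD1, rotated 1]) (simp add: field_simps)
qed

text \<open>The choice of radius makes n times the ball probability equal to exp s times the ball
  average. Along a further subsequence this tends to exp s * f x almost everywhere, and the powers
  are bounded by 1.\<close>

lemma scaled_surv_tendsto: "(\<lambda>n. scaled_surv n s) \<longlonglongrightarrow> limit_surv s"
proof (rule tendsto_subseqI)
  fix u :: "nat \<Rightarrow> nat" assume u: "strict_mono u"
  let ?r = "\<lambda>n. nn_radius (u n) s"
  have r: "?r \<longlonglongrightarrow> 0"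
    using LIMSEQ_subseq_LIMSEQ[OF nn_radius_tendsto u] by (simp add: o_def)
  obtain v where v: "strict_mono v"
     "AE x in lborel. (\<lambda>n. ball_prob x (?r (v n)) / ball_vol (?r (v n)) - f x) \<longlonglongrightarrow> 0"
    using tendsto_L1_AE_subseq[OF ball_prob_tendsto_L1[OF nn_radius_pos r]] by blast
  define k where "k n = u (v n)" for n
  have k: "filterlim k at_top sequentially"
    unfolding k_def using filterlim_subseq[OF strict_mono_o[OF u v(1)]] by (simp add: o_def)
  have ae: "AE x in D. (\<lambda>n. (1 - ball_prob x (nn_radius (k n) s)) ^ k n) \<longlonglongrightarrow> exp (- (exp s * f x))"
  proof (rule AE_D, use v(2) in eventually_elim)
    case (elim x)
    have "(\<lambda>n. exp s * (ball_prob x (?r (v n)) / ball_vol (?r (v n)))) \<longlonglongrightarrow> exp s * f x"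
      by (rule tendsto_mult[OF tendsto_const Lim_null[THEN iffD2, OF elim]])
    moreover have "\<forall>\<^sub>F n in sequentially. exp s * (ball_prob x (?r (v n)) / ball_vol (?r (v n)))
        = real (k n) * ball_prob x (nn_radius (k n) s)"
      \<comment> \<open>The identity for the ball volume needs a positive index, which holds
        eventually.\<close>
      using k[unfolded filterlim_at_top, rule_format, of 1]
    proof eventually_elim
      case (elim n)
      thus ?case using ball_vol_nn_radius[of "k n" s] ball_vol_pos[of "nn_radius (k n) s"]
        by (simp add: k_def[symmetric] field_simps)
    qed
    ultimately have "(\<lambda>n. real (k n) * ball_prob x (nn_radius (k n) s)) \<longlonglongrightarrow> exp s * f x"
      by (rule Lim_transform_eventually)
    thus ?case by (rule tendsto_one_minus_power[OF k])
  qed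
  have "(\<lambda>n. scaled_surv (k n) s) \<longlonglongrightarrow> limit_surv s"
    unfolding scaled_surv_def surv_def limit_surv_def
  proof (rule integral_dominated_convergence[where w="\<lambda>_. 1"])
    show "AE x in D. norm ((1 - ball_prob x (nn_radius (k n) s)) ^ k n) \<le> 1" for n
      using one_minus_ball_prob_power_bounds by auto
  qed (use ae in auto)
  thus "\<exists>v. strict_mono v \<and> (\<lambda>n. scaled_surv (u (v n)) s) \<longlonglongrightarrow> limit_surv s"
    using v(1) by (auto simp: k_def)
qed

subsection \<open>Bounds from the functionals K, Q and T\<close>

lemma I_avg_eq:
  assumes "0 < r"
  shows "I_avg f x r = ennreal (ball_prob x r / ball_vol r)"
proof -
  have "(\<integral>\<^sup>+y\<in>cball x r. ennreal (f y) \<partial>lborel) = ennreal (ball_prob x r)"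
    unfolding ball_prob_def D.emeasure_eq_measure[symmetric]
    by (simp add: D_def emeasure_density)
  thus ?thesis using ball_vol_pos[OF assms]
    by (simp add: I_avg_def divide_ennreal ball_vol_def mult.commute)
qed

text \<open>Uses t^e' \<le> 1 + t^e for e' \<le> e. Lowering the exponent is necessary because the
  Bernoulli type bound works only up to exponent 1.\<close>

lemma nn_integral_avg_powr:
  assumes Q: "Q_fun f e R < \<infinity>" and e: "0 < e'" "e' \<le> e" and r: "0 < r" "r \<le> R"
  shows "(\<integral>\<^sup>+x. ennreal ((ball_prob x r / ball_vol r) powr e') \<partial>D) \<le> ennreal (1 + enn2real (Q_fun f e R))"
proof -
  have nn: "0 \<le> ball_prob x r / ball_vol r" for x
    using ball_vol_pos[OF r(1)] by simp
  have "(\<integral>\<^sup>+x. ennreal ((ball_prob x r / ball_vol r) powr e') \<partial>D)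
      \<le> (\<integral>\<^sup>+x. 1 + ennreal ((ball_prob x r / ball_vol r) powr e) \<partial>D)"
  proof (rule nn_integral_mono)
    fix x
    let ?a = "ball_prob x r / ball_vol r"
    have "?a powr e' \<le> 1 + ?a powr e"
    proof (cases "?a \<le> 1")
      case True
      hence "?a powr e' \<le> 1" using e nn[of x] by (intro powr_le1) auto
      thus ?thesis using powr_ge_zero[of ?a e] by linarith
    next
      case False
      hence "?a powr e' \<le> ?a powr e" using e by (intro powr_mono) auto
      thus ?thesis by simp
    qed
    thus "ennreal (?a powr e') \<le> 1 + ennreal (?a powr e)"
      by (metis ennreal_1 ennreal_leI ennreal_plus powr_ge_zero zero_le_one)
  qed
  also have "\<dots> = 1 + (\<integral>\<^sup>+x. ennreal ((ball_prob x r / ball_vol r) powr e) * ennreal (f x) \<partial>lborel)"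
    using D.emeasure_space_1 by (simp add: nn_integral_add nn_integral_D)
  also have "(\<integral>\<^sup>+x. ennreal ((ball_prob x r / ball_vol r) powr e) * ennreal (f x) \<partial>lborel) \<le> Q_fun f e R"
    unfolding Q_fun_def
  proof (intro nn_integral_mono mult_right_mono)
    fix x
    have "ennreal ((ball_prob x r / ball_vol r) powr e) = ennpowr (I_avg f x r) e"
      using nn[of x] r by (simp add: I_avg_eq ennpowr_ennreal)
    also have "\<dots> \<le> ennpowr (M_max f x R) e"
      using e r unfolding M_max_def by (intro ennpowr_mono SUP_upper) auto
    finally show "ennreal ((ball_prob x r / ball_vol r) powr e) \<le> ennpowr (M_max f x R) e" .
  qed simp
  also have "1 + Q_fun f e R = ennreal (1 + enn2real (Q_fun f e R))"
    using Q by (simp add: ennreal_plus)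
  finally show ?thesis by (simp add: add_left_mono)
qed

text \<open>Writing the ball probability as volume times average splits the bound of
  \<open>one_minus_power_le_powr\<close> into a deterministic factor and a moment controlled by
  Q.\<close>

lemma surv_ge:
  assumes Q: "Q_fun f e R < \<infinity>" and e: "0 < e'" "e' \<le> e" "e' \<le> 1" and r: "0 < r" "r \<le> R"
  shows "1 - surv n r \<le> (real n * ball_vol r) powr e' * (1 + enn2real (Q_fun f e R))"
proof -
  have v: "0 < ball_vol r" by (rule ball_vol_pos) fact
  have "ennreal (1 - surv n r) \<le> (\<integral>\<^sup>+x. ennreal ((real n * ball_vol r) powr e')
      * ennreal ((ball_prob x r / ball_vol r) powr e') \<partial>D)"
    unfolding ennreal_one_minus_surv
  proof (rule nn_integral_mono)
    fix x
    have "1 - (1 - ball_prob x r) ^ n \<le> (real n * ball_prob x r) powr e'"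
      by (rule one_minus_power_le_powr) (use e in auto)
    also have "\<dots> = (real n * ball_vol r) powr e' * (ball_prob x r / ball_vol r) powr e'"
      using v by (subst powr_mult[symmetric]) auto
    finally show "ennreal (1 - (1 - ball_prob x r) ^ n) \<le> ennreal ((real n * ball_vol r) powr e')
      * ennreal ((ball_prob x r / ball_vol r) powr e')"
      by (simp add: ennreal_mult'[symmetric] ennreal_leI)
  qed
  also have "\<dots> = ennreal ((real n * ball_vol r) powr e') * (\<integral>\<^sup>+x. ennreal ((ball_prob x r / ball_vol r) powr e') \<partial>D)"
    by (simp add: nn_integral_cmult)
  also have "\<dots> \<le> ennreal ((real n * ball_vol r) powr e') * ennreal (1 + enn2real (Q_fun f e R))"
    by (intro mult_left_mono nn_integral_avg_powr[OF Q e(1,2) r]) simp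
  also have "\<dots> = ennreal ((real n * ball_vol r) powr e' * (1 + enn2real (Q_fun f e R)))"
    by (rule ennreal_mult'[symmetric]) simp
  finally show ?thesis by (subst (asm) ennreal_le_iff) auto
qed

text \<open>The average at radius r is at least \<open>m_min\<close>. The extended inverse keeps the
  bound valid where the ball has probability 0.\<close>

lemma nn_integral_inverse_avg:
  assumes e: "0 < e" and r: "0 < r" "r \<le> R"
  shows "(\<integral>\<^sup>+x. inverse (ennreal ((ball_prob x r / ball_vol r) powr e)) \<partial>D) \<le> T_fun f e R"
proof -
  have nn: "0 \<le> ball_prob x r / ball_vol r" for x
    using ball_vol_pos[OF r(1)] by simp
  have "(\<integral>\<^sup>+x. inverse (ennreal ((ball_prob x r / ball_vol r) powr e)) \<partial>D)
     = (\<integral>\<^sup>+x. inverse (ennreal ((ball_prob x r / ball_vol r) powr e)) * ennreal (f x) \<partial>lborel)"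
    by (simp add: nn_integral_D)
  also have "\<dots> \<le> T_fun f e R"
    unfolding T_fun_def
  proof (intro nn_integral_mono mult_right_mono)
    fix x
    have "ennpowr (m_min f x R) e \<le> ennpowr (I_avg f x r) e"
      using e r unfolding m_min_def by (intro ennpowr_mono INF_lower) auto
    also have "\<dots> = ennreal ((ball_prob x r / ball_vol r) powr e)"
      using nn[of x] r by (simp add: I_avg_eq ennpowr_ennreal)
    finally show "inverse (ennreal ((ball_prob x r / ball_vol r) powr e)) \<le> inverse (ennpowr (m_min f x R) e)"
      by (rule le_imp_inverse_le_ennreal)
  qed simp
  finally show ?thesis .
qed

text \<open>Where the ball has probability 0 the inverse power is infinite, and finiteness of T
  allows this only on a null set.\<close>

lemma AE_ball_prob_pos:
  assumes T: "T_fun f e R < \<infinity>" and e: "0 < e" and R: "0 < R"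
  shows "AE x in D. 0 < ball_prob x R"
proof -
  have "AE x in D. inverse (ennreal ((ball_prob x R / ball_vol R) powr e)) \<noteq> \<infinity>"
    using nn_integral_inverse_avg[OF e R order_refl] T by (intro nn_integral_PInf_AE) auto
  thus ?thesis
  proof eventually_elim
    case (elim x)
    hence "ball_prob x R \<noteq> 0" by auto
    thus ?case using ball_prob_bounds(1)[of x R] by linarith
  qed
qed

text \<open>The counterpart of \<open>surv_ge\<close> with negative exponent:
  \<open>one_minus_power_le_powr_uminus\<close> splits off a deterministic factor and leaves an
  inverse moment controlled by T.\<close>

lemma surv_le:
  assumes T: "T_fun f e R < \<infinity>" and e: "0 < e" and r: "0 < r" "r \<le> R" and n: "0 < n"
  shows "surv n r \<le> e powr e * (real n * ball_vol r) powr (- e) * enn2real (T_fun f e R)"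
proof -
  have v: "0 < ball_vol r" by (rule ball_vol_pos) fact
  let ?c = "e powr e * (real n * ball_vol r) powr (- e)"
  have c: "?c > 0" using e n v by simp
  have "ennreal (surv n r) \<le> (\<integral>\<^sup>+x. ennreal ?c * inverse (ennreal ((ball_prob x r / ball_vol r) powr e)) \<partial>D)"
    unfolding ennreal_surv
  proof (rule nn_integral_mono)
    fix x
    show "ennreal ((1 - ball_prob x r) ^ n) \<le> ennreal ?c * inverse (ennreal ((ball_prob x r / ball_vol r) powr e))"
    proof (cases "ball_prob x r = 0")
      case True
      \<comment> \<open>The right side is \<infinity> here, as its constant is positive and
        \<open>inverse 0 = \<infinity>\<close>.\<close>
      thus ?thesis using e n v by (simp add: ennreal_mult_top)
    next
      case False
      hence p: "ball_prob x r > 0" using ball_prob_bounds(1)[of x r] by linarith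
      have "(1 - ball_prob x r) ^ n \<le> e powr e * (real n * ball_prob x r) powr (- e)"
        by (rule one_minus_power_le_powr_uminus) (use e n p in auto)
      also have "real n * ball_prob x r = (real n * ball_vol r) * (ball_prob x r / ball_vol r)"
        using v by simp
      also have "\<dots> powr (- e) = (real n * ball_vol r) powr (- e) * inverse ((ball_prob x r / ball_vol r) powr e)"
        using v p by (subst powr_mult) (auto simp: powr_minus)
      finally have "ennreal ((1 - ball_prob x r) ^ n) \<le> ennreal (?c * inverse ((ball_prob x r / ball_vol r) powr e))"
        by (intro ennreal_leI) (simp add: mult.assoc)
      also have "\<dots> = ennreal ?c * inverse (ennreal ((ball_prob x r / ball_vol r) powr e))"
        using c p v by (simp add: ennreal_mult inverse_ennreal)
      finally show ?thesis .
    qed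
  qed
  also have "\<dots> = ennreal ?c * (\<integral>\<^sup>+x. inverse (ennreal ((ball_prob x r / ball_vol r) powr e)) \<partial>D)"
    by (simp add: nn_integral_cmult)
  also have "\<dots> \<le> ennreal ?c * T_fun f e R"
    by (intro mult_left_mono nn_integral_inverse_avg e r) simp
  also have "\<dots> = ennreal (?c * enn2real (T_fun f e R))"
    using T c by (simp add: ennreal_mult)
  finally show ?thesis by (subst (asm) ennreal_le_iff) (use c in auto)
qed

text \<open>Large values of ln (dist x y) are bounded by the integrand of K and the others by a
  constant. Then t \<le> 1 + t^(1 + e) is applied to the inner integral.\<close>

lemma ln_dist_integral:
  assumes K: "K_fun f e < \<infinity>" and e: "0 < e"
  shows "(\<integral>\<^sup>+x. \<integral>\<^sup>+y. ennreal (max 0 (ln (dist x y) - b)) \<partial>D \<partial>D) < \<infinity>"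
proof -
  \<comment> \<open>Beyond this threshold t = ln (dist x y) is at least exp 1, so ln t \<ge> 1 and t
    \<le> t ln t.\<close>
  define g where "g x y = (if exp (exp 1) \<le> dist x y then ennreal (ln (dist x y)) else 0)" for x y :: 'a
  have [measurable]: "(\<lambda>x. g (h x) (h' x)) \<in> borel_measurable N"
    if "h \<in> borel_measurable N" "h' \<in> borel_measurable N" for h h' and N :: "'c measure"
    using that unfolding g_def by measurable
  have g_le: "g x y \<le> G_fun \<bar>elog (dist x y)\<bar>" for x y
  proof (cases "exp (exp 1) \<le> dist x y")
    case True
    define t where "t = ln (dist x y)"
    have d: "dist x y > 0" using True less_le_trans[OF exp_gt_zero] by blast
    have t: "exp 1 \<le> t" using True d by (simp add: t_def ln_ge_iff)
    have t1: "1 < t" using t exp_ge_add_one_self[of 1] by simp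
    have "1 \<le> ln t" using t t1 by (simp add: ln_ge_iff)
    hence "t * 1 \<le> t * ln t" using t1 by (intro mult_left_mono) auto
    moreover have "G_fun \<bar>elog (dist x y)\<bar> = ennreal (t * ln t)"
      using d t1 by (auto simp: G_fun_def elog_def t_def[symmetric] one_ereal_def)
    ultimately show ?thesis using True by (simp add: g_def t_def[symmetric] ennreal_leI)
  qed (simp add: g_def)
  define k where "k x = (\<integral>\<^sup>+y. g x y \<partial>D)" for x
  have [measurable]: "k \<in> borel_measurable borel" unfolding k_def by measurable
  have kp [measurable]: "(\<lambda>x. ennpowr (k x) (1 + e)) \<in> borel_measurable borel"
    unfolding ennpowr_def by measurable
  have "(\<integral>\<^sup>+x. ennpowr (k x) (1 + e) \<partial>D) \<le> K_fun f e"
  proof -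
    have "(\<integral>\<^sup>+x. ennpowr (k x) (1 + e) \<partial>D) = (\<integral>\<^sup>+x. ennpowr (k x) (1 + e) * ennreal (f x) \<partial>lborel)"
      by (rule nn_integral_D) measurable
    also have "\<dots> \<le> K_fun f e"
      unfolding K_fun_def k_def
      by (subst nn_integral_D, measurable)
         (use e in \<open>auto intro!: nn_integral_mono mult_right_mono ennpowr_mono g_le\<close>)
    finally show ?thesis .
  qed
  hence kp_fin: "(\<integral>\<^sup>+x. ennpowr (k x) (1 + e) \<partial>D) < \<infinity>" using K by simp
  have "ennreal (max 0 (ln (dist x y) - b)) \<le> ennreal (exp 1 + \<bar>b\<bar>) + g x y" for x y :: 'a
  proof (cases "exp (exp 1) \<le> dist x y")
    case True
    hence "0 < dist x y" using less_le_trans[OF exp_gt_zero] by blast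
    hence "exp 1 \<le> ln (dist x y)" using True by (simp add: ln_ge_iff)
    hence "0 \<le> ln (dist x y)" using exp_gt_zero[of "1::real"] by linarith
    moreover have "- b \<le> exp 1 + \<bar>b\<bar>" using exp_gt_zero[of "1::real"] by linarith
    ultimately show ?thesis using True
      by (auto simp: g_def ennreal_plus[symmetric] simp del: ennreal_plus intro!: ennreal_leI)
  next
    case False
    have "ln (dist x y) \<le> exp 1"
    \<comment> \<open>For coincident points the bound holds by \<open>ln 0 = 0\<close>.\<close>
    proof (cases "dist x y = 0")
      case False
      hence "0 < dist x y" by simp
      thus ?thesis using \<open>\<not> exp (exp 1) \<le> dist x y\<close>
        by (metis le_cases ln_exp ln_le_cancel_iff exp_gt_zero)
    qed simp
    moreover have "0 < exp (1::real)" by simp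
    ultimately have "max 0 (ln (dist x y) - b) \<le> exp 1 + \<bar>b\<bar>" by linarith
    thus ?thesis using False by (simp add: g_def ennreal_leI del: ennreal_plus)
  qed
  hence "(\<integral>\<^sup>+x. \<integral>\<^sup>+y. ennreal (max 0 (ln (dist x y) - b)) \<partial>D \<partial>D)
     \<le> (\<integral>\<^sup>+x. \<integral>\<^sup>+y. ennreal (exp 1 + \<bar>b\<bar>) + g x y \<partial>D \<partial>D)"
    by (intro nn_integral_mono)
  also have "\<dots> = ennreal (exp 1 + \<bar>b\<bar>) + (\<integral>\<^sup>+x. k x \<partial>D)"
    using D.emeasure_space_1 by (simp add: nn_integral_add k_def)
  also have "(\<integral>\<^sup>+x. k x \<partial>D) \<le> (\<integral>\<^sup>+x. 1 + ennpowr (k x) (1 + e) \<partial>D)"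
    using e by (intro nn_integral_mono le_one_plus_ennpowr) simp
  also have "\<dots> = 1 + (\<integral>\<^sup>+x. ennpowr (k x) (1 + e) \<partial>D)"
    using D.emeasure_space_1 by (simp add: nn_integral_add)
  also have "ennreal (exp 1 + \<bar>b\<bar>) + (1 + (\<integral>\<^sup>+x. ennpowr (k x) (1 + e) \<partial>D)) < \<infinity>"
    using kp_fin by simp
  finally show ?thesis by (simp add: add_left_mono)
qed

text \<open>The variable t is the logarithm of the radius. In it the domain of integration does not
  depend on n, so the values are comparable for different n.\<close>

definition tail :: "nat \<Rightarrow> real \<Rightarrow> ennreal" where
  "tail n b = (\<integral>\<^sup>+t. of_bool (b < t) * ennreal (surv n (exp t)) \<partial>lborel)"

text \<open>\<open>surv 1 r\<close> is the probability that two independent points are farther than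
  r apart. By Tonelli, integrating it over ln r > b is bounded by the mean positive part of ln (dist
  x y) - b.\<close>

lemma tail_1_finite:
  assumes K: "K_fun f e < \<infinity>" and e: "0 < e"
  shows "tail 1 b < \<infinity>"
proof -
  interpret DD: pair_prob_space D D ..
  interpret LP: pair_sigma_finite lborel "D \<Otimes>\<^sub>M D" ..
  have s: "ennreal (surv 1 r) = (\<integral>\<^sup>+z. of_bool (r < dist (fst z) (snd z)) \<partial>(D \<Otimes>\<^sub>M D))" for r
  proof -
    have "ennreal (surv 1 r) = (\<integral>\<^sup>+x. \<integral>\<^sup>+y. of_bool (r < dist x y) \<partial>D \<partial>D)"
      unfolding ennreal_surv
    proof (rule nn_integral_cong)
      fix x
      have "(\<integral>\<^sup>+y. of_bool (r < dist x y) \<partial>D) = (\<integral>\<^sup>+y. indicator (UNIV - cball x r) y \<partial>D)"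
        by (intro nn_integral_cong) (auto simp: indicator_def)
      also have "\<dots> = ennreal (1 - ball_prob x r)"
        using D.prob_compl[of "cball x r"] by (simp add: D.emeasure_eq_measure ball_prob_def)
      finally show "ennreal ((1 - ball_prob x r) ^ 1) = (\<integral>\<^sup>+y. of_bool (r < dist x y) \<partial>D)" by simp
    qed
    thus ?thesis by (subst D.nn_integral_fst[symmetric]) simp_all
  qed
  have "tail 1 b = (\<integral>\<^sup>+t. \<integral>\<^sup>+z. of_bool (b < t) * of_bool (exp t < dist (fst z) (snd z)) \<partial>(D \<Otimes>\<^sub>M D) \<partial>lborel)"
    unfolding tail_def s by (simp add: nn_integral_cmult)
  also have "\<dots> = (\<integral>\<^sup>+z. \<integral>\<^sup>+t. of_bool (b < t) * of_bool (exp t < dist (fst z) (snd z)) \<partial>lborel \<partial>(D \<Otimes>\<^sub>M D))"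
    by (rule LP.Fubini'[symmetric]) measurable
  also have "\<dots> \<le> (\<integral>\<^sup>+z. ennreal (max 0 (ln (dist (fst z) (snd z)) - b)) \<partial>(D \<Otimes>\<^sub>M D))"
  proof (rule nn_integral_mono)
    fix z :: "'a \<times> 'a"
    let ?d = "dist (fst z) (snd z)"
    have "(\<integral>\<^sup>+t. of_bool (b < t) * of_bool (exp t < ?d) \<partial>lborel)
       \<le> (\<integral>\<^sup>+t. indicator {b..max b (ln ?d)} t \<partial>lborel)"
    proof (rule nn_integral_mono)
      fix t
      have "t < ln ?d" if "exp t < ?d"
        using that by (metis exp_gt_zero less_trans ln_exp ln_less_cancel_iff)
      thus "of_bool (b < t) * of_bool (exp t < ?d) \<le> (indicator {b..max b (ln ?d)} t :: ennreal)"
        by (auto simp: indicator_def)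
    qed
    also have "\<dots> = ennreal (max b (ln ?d) - b)" by simp
    also have "max b (ln ?d) - b = max 0 (ln ?d - b)" by auto
    finally show "(\<integral>\<^sup>+t. of_bool (b < t) * of_bool (exp t < ?d) \<partial>lborel) \<le> ennreal (max 0 (ln ?d - b))" .
  qed
  also have "\<dots> = (\<integral>\<^sup>+x. \<integral>\<^sup>+y. ennreal (max 0 (ln (dist x y) - b)) \<partial>D \<partial>D)"
    by (subst D.nn_integral_fst[symmetric]) simp_all
  also have "\<dots> < \<infinity>" by (rule ln_dist_integral[OF K e])
  finally show ?thesis .
qed

text \<open>The integrand at exponent 1 dominates all later ones. For r \<ge> R the ball probability
  is positive almost everywhere, so the powers tend to 0.\<close>

lemma tail_tendsto_0:
  assumes K: "K_fun f e < \<infinity>" and e: "0 < e"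
    and T: "T_fun f e' R < \<infinity>" and e': "0 < e'" and R: "0 < R"
  shows "(\<lambda>n. tail (Suc n) (ln R)) \<longlonglongrightarrow> 0"
proof -
  have lim: "(\<lambda>n. surv (Suc n) r) \<longlonglongrightarrow> 0" if r: "R \<le> r" for r
  proof -
    have "(\<lambda>n. surv n r) \<longlonglongrightarrow> (\<integral>x. 0 \<partial>D)"
      unfolding surv_def
    proof (rule integral_dominated_convergence[where w="\<lambda>_. 1"])
      show "AE x in D. norm ((1 - ball_prob x r) ^ n) \<le> 1" for n
        using one_minus_ball_prob_power_bounds by auto
      show "AE x in D. (\<lambda>n. (1 - ball_prob x r) ^ n) \<longlonglongrightarrow> 0"
        using AE_ball_prob_pos[OF T e' R]
      proof eventually_elim
        case (elim x)
        hence "0 < ball_prob x r" using ball_prob_mono[OF r, of x] by linarith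
        hence "norm (1 - ball_prob x r) < 1" using ball_prob_bounds(2)[of x r] by (simp add: abs_less_iff)
        thus ?case by (rule LIMSEQ_power_zero)
      qed
    qed auto
    from LIMSEQ_Suc[OF this] show ?thesis by simp
  qed
  have "(\<lambda>n. tail (Suc n) (ln R)) \<longlonglongrightarrow> (\<integral>\<^sup>+t. 0 \<partial>(lborel :: real measure))"
    unfolding tail_def
  proof (rule nn_integral_dominated_convergence[where w="\<lambda>t. of_bool (ln R < t) * ennreal (surv 1 (exp t))"])
    show "AE t in lborel. of_bool (ln R < t) * ennreal (surv (Suc n) (exp t)) \<le> of_bool (ln R < t) * ennreal (surv 1 (exp t))" for n
      by (intro AE_I2 mult_left_mono ennreal_leI surv_antimono_n) auto
    show "(\<integral>\<^sup>+t. of_bool (ln R < t) * ennreal (surv 1 (exp t)) \<partial>lborel) < \<infinity>"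
      using tail_1_finite[OF K e] by (simp add: tail_def)
    show "AE t in lborel. (\<lambda>n. of_bool (ln R < t) * ennreal (surv (Suc n) (exp t))) \<longlonglongrightarrow> 0"
    proof (rule AE_I2)
      fix t
      show "(\<lambda>n. of_bool (ln R < t) * ennreal (surv (Suc n) (exp t))) \<longlonglongrightarrow> 0"
      proof (cases "ln R < t")
        case True
        hence "R \<le> exp t" using R by (metis exp_le_cancel_iff exp_ln less_imp_le)
        hence "(\<lambda>n. ennreal (surv (Suc n) (exp t))) \<longlonglongrightarrow> ennreal 0"
          by (intro tendsto_ennrealI lim)
        thus ?thesis using True by simp
      qed simp
    qed
  qed auto
  thus ?thesis by simp
qed

section \<open>Change of variables between the level s and the radius\<close>

lemma nn_radius_mono: "s \<le> s' \<Longrightarrow> nn_radius n s \<le> nn_radius n s'"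
  unfolding nn_radius_def by (simp add: divide_right_mono)

lemma scaled_surv_measurable [measurable]: "scaled_surv n \<in> borel_measurable borel"
proof -
  have "(\<lambda>s. - scaled_surv n s) \<in> borel_measurable borel"
    by (rule borel_measurable_mono) (auto simp: mono_def scaled_surv_def intro!: surv_antimono nn_radius_mono)
  thus ?thesis by simp
qed

lemma scaled_surv_bounds [simp]: "0 \<le> scaled_surv n s" "scaled_surv n s \<le> 1"
  by (simp_all add: scaled_surv_def surv_nonneg surv_le_1)

lemma nn_radius_le_iff:
  assumes "0 < R" "0 < n"
  shows "nn_radius n s \<le> R \<longleftrightarrow> s \<le> ln (real n * ball_vol R)"
proof -
  have "nn_radius n s \<le> R \<longleftrightarrow> (s - ln (real n * unit_ball_vol (real DIM('a)))) / real DIM('a) \<le> ln R"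
    using assms by (simp add: nn_radius_def ln_ge_iff)
  also have "\<dots> \<longleftrightarrow> s \<le> ln (real n * unit_ball_vol (real DIM('a))) + real DIM('a) * ln R"
    by (auto simp: field_simps)
  also have "ln (real n * unit_ball_vol (real DIM('a))) + real DIM('a) * ln R = ln (real n * ball_vol R)"
    using assms by (simp add: ball_vol_def ln_mult ln_realpow)
  finally show ?thesis .
qed

text \<open>Substitute s = l + d t, for which the radius is exp t; the factor d is the
  Jacobian.\<close>

lemma tail_scaled_surv:
  assumes R: "0 < R" and n: "0 < n"
  shows "(\<integral>\<^sup>+s. of_bool (ln (real n * ball_vol R) < s) * ennreal (scaled_surv n s) \<partial>lborel)
    = ennreal (real DIM('a)) * tail n (ln R)"
proof -
  define l where "l = ln (real n * unit_ball_vol (real DIM('a)))"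
  have *: "ln (real n * ball_vol R) < l + real DIM('a) * t \<longleftrightarrow> ln R < t" for t
    using assms by (simp add: l_def ball_vol_def ln_mult ln_realpow)
  have "(\<integral>\<^sup>+s. of_bool (ln (real n * ball_vol R) < s) * ennreal (scaled_surv n s) \<partial>lborel)
    = ennreal \<bar>real DIM('a)\<bar> * (\<integral>\<^sup>+t. of_bool (ln (real n * ball_vol R) < l + real DIM('a) * t)
        * ennreal (scaled_surv n (l + real DIM('a) * t)) \<partial>lborel)"
    by (rule nn_integral_real_affine) auto
  also have "(\<lambda>t. of_bool (ln (real n * ball_vol R) < l + real DIM('a) * t)
        * ennreal (scaled_surv n (l + real DIM('a) * t)))
     = (\<lambda>t. of_bool (ln R < t) * ennreal (surv n (exp t)))"
    unfolding * by (simp add: scaled_surv_def nn_radius_def l_def)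
  finally show ?thesis by (simp add: tail_def)
qed

end

subsection \<open>Passage to the limit\<close>

locale kl_density = density_prob f for f :: "'a::euclidean_space \<Rightarrow> real" +
  fixes e0 e1 e2 R1 R2 :: real
  assumes pos: "0 < e0" "0 < e1" "0 < e2" "0 < R1" "0 < R2"
    and K: "K_fun f e0 < \<infinity>" and Q: "Q_fun f e1 R1 < \<infinity>" and T: "T_fun f e2 R2 < \<infinity>"
begin

text \<open>For n > 0, levels beyond the cutoff are those with s > 0 and radius above R2. The
  maximum with 0 leaves the correction term for s < 0 entirely to \<open>head_part\<close>.\<close>

definition cutoff :: "nat \<Rightarrow> real" where
  "cutoff n = max 0 (ln (real n * ball_vol R2))"

definition head_part :: "nat \<Rightarrow> real \<Rightarrow> real" where
  "head_part n s = (if cutoff n < s then 0 else scaled_surv n s - of_bool (s < 0))"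

definition tail_part :: "nat \<Rightarrow> real \<Rightarrow> real" where
  "tail_part n s = (if cutoff n < s then scaled_surv n s else 0)"

lemma split_parts: "scaled_surv n s - of_bool (s < 0) = head_part n s + tail_part n s"
  by (simp add: head_part_def tail_part_def cutoff_def)

lemma parts_measurable [measurable]:
  "head_part n \<in> borel_measurable borel" "tail_part n \<in> borel_measurable borel"
  unfolding head_part_def tail_part_def by measurable

lemma nn_integral_tail_part:
  assumes "0 < n"
  shows "(\<integral>\<^sup>+s. ennreal (tail_part n s) \<partial>lborel) \<le> ennreal (real DIM('a)) * tail n (ln R2)"
  unfolding tail_scaled_surv[OF pos(5) assms, symmetric]
  by (intro nn_integral_mono) (auto simp: tail_part_def cutoff_def)

lemma tail_finite: "tail (Suc n) (ln R2) < \<infinity>"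
proof -
  have "tail (Suc n) (ln R2) \<le> tail 1 (ln R2)"
    unfolding tail_def by (intro nn_integral_mono mult_left_mono ennreal_leI surv_antimono_n) auto
  thus ?thesis using tail_1_finite[OF K pos(1), of "ln R2"] by simp
qed

lemma integrable_tail_part: "integrable lborel (tail_part (Suc n))"
proof (rule integrableI_nonneg)
  have "(\<integral>\<^sup>+s. ennreal (tail_part (Suc n) s) \<partial>lborel) \<le> ennreal (real DIM('a)) * tail (Suc n) (ln R2)"
    by (rule nn_integral_tail_part) simp
  also have "\<dots> < \<infinity>" using tail_finite[of n] by (simp add: ennreal_mult_less_top)
  finally show "(\<integral>\<^sup>+s. ennreal (tail_part (Suc n) s) \<partial>lborel) < \<infinity>" .
qed (auto simp: tail_part_def)

lemma integral_tail_part_tendsto: "(\<lambda>n. \<integral>s. tail_part (Suc n) s \<partial>lborel) \<longlonglongrightarrow> 0"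
proof -
  have nn: "0 \<le> tail_part n s" for n s by (simp add: tail_part_def)
  have "(\<lambda>n. ennreal (\<integral>s. tail_part (Suc n) s \<partial>lborel)) \<longlonglongrightarrow> ennreal 0"
  proof (rule tendsto_sandwich[where f="\<lambda>_. 0" and h="\<lambda>n. ennreal (real DIM('a)) * tail (Suc n) (ln R2)"])
    show "\<forall>\<^sub>F n in sequentially. ennreal (\<integral>s. tail_part (Suc n) s \<partial>lborel)
        \<le> ennreal (real DIM('a)) * tail (Suc n) (ln R2)"
    proof (intro always_eventually allI)
      fix n
      have "ennreal (\<integral>s. tail_part (Suc n) s \<partial>lborel) = (\<integral>\<^sup>+s. ennreal (tail_part (Suc n) s) \<partial>lborel)"
        by (rule nn_integral_eq_integral[symmetric, OF integrable_tail_part]) (simp add: nn)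
      thus "ennreal (\<integral>s. tail_part (Suc n) s \<partial>lborel) \<le> ennreal (real DIM('a)) * tail (Suc n) (ln R2)"
        using nn_integral_tail_part[of "Suc n"] by simp
    qed
    have "(\<lambda>n. ennreal (real DIM('a)) * tail (Suc n) (ln R2)) \<longlonglongrightarrow> ennreal (real DIM('a)) * 0"
      by (intro ennreal_tendsto_cmult tail_tendsto_0[OF K pos(1) T pos(3,5)]) simp
    thus "(\<lambda>n. ennreal (real DIM('a)) * tail (Suc n) (ln R2)) \<longlonglongrightarrow> ennreal 0" by simp
  qed auto
  thus ?thesis by (rule tendsto_ennrealD) (auto simp: nn)
qed

text \<open>The exponent is capped at 1 as \<open>surv_ge\<close> demands.\<close>

definition e1' :: real where "e1' = min e1 1"

text \<open>The first two summands come from Q; the last one covers levels s \<le> 0 whose radius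
  exceeds R1.\<close>

definition bound_left :: real where
  "bound_left = 1 + enn2real (Q_fun f e1 R1) + exp (- (e1' * ln (ball_vol R1)))"

definition bound_right :: real where
  "bound_right = e2 powr e2 * enn2real (T_fun f e2 R2)"

definition dominator :: "real \<Rightarrow> real" where
  "dominator s = bound_left * (of_bool (0 \<le> - s) * exp (- (e1' * - s)))
     + bound_right * (of_bool (0 \<le> s) * exp (- (e2 * s)))"

lemma e1'_pos: "0 < e1'" "e1' \<le> e1" "e1' \<le> 1"
  using pos by (auto simp: e1'_def)

lemma bounds_ge: "1 \<le> bound_left" "0 \<le> bound_right"
  by (simp_all add: bound_left_def bound_right_def add_increasing2)

lemma integrable_dominator: "integrable lborel dominator"
proof -
  have "integrable lborel (\<lambda>s. of_bool (0 \<le> 0 + -1 * s) * exp (- (e1' * (0 + -1 * s))))"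
    by (rule lborel_integrable_real_affine) (use integrable_exp_uminus[OF e1'_pos(1)] in auto)
  thus ?thesis
    unfolding dominator_def[abs_def] using integrable_exp_uminus[OF pos(3)]
    by (intro Bochner_Integration.integrable_add integrable_mult_right) auto
qed

text \<open>For radii up to R1 this is \<open>surv_ge\<close>. For larger ones s exceeds ln
  (ball_vol R1), and then the last summand of \<open>bound_left\<close> alone makes the right side
  at least 1.\<close>

lemma scaled_surv_ge:
  assumes n: "0 < n" and s: "s \<le> 0"
  shows "1 - scaled_surv n s \<le> bound_left * exp (e1' * s)"
proof (cases "nn_radius n s \<le> R1")
  case True
  have "1 - scaled_surv n s \<le> (real n * ball_vol (nn_radius n s)) powr e1' * (1 + enn2real (Q_fun f e1 R1))"
    unfolding scaled_surv_def by (rule surv_ge[OF Q e1'_pos nn_radius_pos True])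
  also have "(real n * ball_vol (nn_radius n s)) powr e1' = exp (e1' * s)"
    using n by (simp add: ball_vol_nn_radius powr_def)
  also have "\<dots> * (1 + enn2real (Q_fun f e1 R1)) \<le> exp (e1' * s) * bound_left"
    by (intro mult_left_mono) (auto simp: bound_left_def)
  finally show ?thesis by (simp add: mult.commute)
next
  case False
  have "ball_vol R1 \<le> real n * ball_vol R1"
    using n ball_vol_pos[OF pos(4)] by simp
  hence "ln (ball_vol R1) \<le> ln (real n * ball_vol R1)"
    using n ball_vol_pos[OF pos(4)] by (subst ln_le_cancel_iff) auto
  also have "\<dots> < s" using False nn_radius_le_iff[OF pos(4) n] by simp
  finally have "1 \<le> exp (e1' * s - e1' * ln (ball_vol R1))"
    using e1'_pos by simp
  also have "\<dots> = exp (- (e1' * ln (ball_vol R1))) * exp (e1' * s)"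
    by (simp add: exp_diff exp_minus field_simps)
  also have "\<dots> \<le> bound_left * exp (e1' * s)"
    by (intro mult_right_mono) (auto simp: bound_left_def add_increasing)
  finally show ?thesis using scaled_surv_bounds(1)[of n s] by linarith
qed

lemma norm_head_part_le:
  assumes n: "0 < n"
  shows "norm (head_part n s) \<le> dominator s"
proof -
  have d: "0 \<le> dominator s" using bounds_ge by (simp add: dominator_def)
  consider "cutoff n < s" | "s < 0" | "s = 0" | "0 < s" "s \<le> cutoff n" by linarith
  thus ?thesis
  proof cases
    case 1
    thus ?thesis using d by (simp add: head_part_def)
  next
    case 2
    hence "norm (head_part n s) \<le> 1 - scaled_surv n s"
      by (auto simp: head_part_def)
    thus ?thesis using 2 scaled_surv_ge[OF n, of s] by (simp add: dominator_def)
  next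
    \<comment> \<open>At s = 0 the head part is a survival probability, and
      \<open>1 \<le> bound_left\<close> suffices.\<close>
    case 3
    hence "norm (head_part n s) \<le> 1" by (auto simp: head_part_def)
    thus ?thesis using 3 bounds_ge by (simp add: dominator_def)
  next
    case 4
    hence "s \<le> ln (real n * ball_vol R2)" by (auto simp: cutoff_def)
    hence r: "nn_radius n s \<le> R2" using nn_radius_le_iff[OF pos(5) n] by simp
    have "norm (head_part n s) = scaled_surv n s" using 4 by (simp add: head_part_def)
    also have "\<dots> \<le> e2 powr e2 * (real n * ball_vol (nn_radius n s)) powr (- e2) * enn2real (T_fun f e2 R2)"
      unfolding scaled_surv_def by (rule surv_le[OF T pos(3) nn_radius_pos r n])
    also have "(real n * ball_vol (nn_radius n s)) powr (- e2) = exp (- (e2 * s))"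
      using n by (simp add: ball_vol_nn_radius powr_def)
    finally show ?thesis using 4 by (simp add: dominator_def bound_right_def mult_ac)
  qed
qed

lemma limit_surv_measurable [measurable]: "limit_surv \<in> borel_measurable borel"
  by (rule borel_measurable_LIMSEQ_real[OF scaled_surv_tendsto]) measurable

text \<open>For fixed s the cutoff eventually passes s, so the head part is then the whole
  integrand.\<close>

lemma head_part_tendsto: "(\<lambda>n. head_part (Suc n) s) \<longlonglongrightarrow> limit_surv s - of_bool (s < 0)"
proof -
  have v: "0 < ball_vol R2" using pos by (simp add: ball_vol_pos)
  obtain N :: nat where N: "exp s / ball_vol R2 < real N" using reals_Archimedean2 by blast
  have "\<forall>\<^sub>F n in sequentially. scaled_surv (Suc n) s - of_bool (s < 0) = head_part (Suc n) s"
  proof (rule eventually_sequentiallyI[of N])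
    fix n assume "N \<le> n"
    hence "exp s / ball_vol R2 \<le> real (Suc n)" using N by linarith
    hence "exp s \<le> real (Suc n) * ball_vol R2" using v by (simp add: divide_le_eq)
    hence "s \<le> ln (real (Suc n) * ball_vol R2)" using v by (subst ln_ge_iff) auto
    thus "scaled_surv (Suc n) s - of_bool (s < 0) = head_part (Suc n) s"
      by (auto simp: head_part_def cutoff_def)
  qed
  moreover have "(\<lambda>n. scaled_surv (Suc n) s - of_bool (s < 0)) \<longlonglongrightarrow> limit_surv s - of_bool (s < 0)"
    by (intro tendsto_diff tendsto_const LIMSEQ_Suc scaled_surv_tendsto)
  ultimately show ?thesis by (rule Lim_transform_eventually[rotated])
qed

lemma integrable_head_part: "integrable lborel (head_part (Suc n))"
  using integrable_dominator
  by (rule Bochner_Integration.integrable_bound) (use norm_head_part_le[of "Suc n"] in \<open>auto intro!: AE_I2 order_trans[OF _ abs_ge_self]\<close>)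

lemma integrable_scaled_surv: "integrable lborel (\<lambda>s. scaled_surv (Suc n) s - of_bool (s < 0))"
  unfolding split_parts using integrable_head_part integrable_tail_part
  by (rule Bochner_Integration.integrable_add)

text \<open>Dominated convergence handles the head part, which also gives integrability of the
  limit; the integrals of the tail part vanish.\<close>

lemma limit_surv_integral:
  shows "integrable lborel (\<lambda>s. limit_surv s - of_bool (s < 0))"
    and "(\<lambda>n. \<integral>s. scaled_surv (Suc n) s - of_bool (s < 0) \<partial>lborel)
      \<longlonglongrightarrow> (\<integral>s. limit_surv s - of_bool (s < 0) \<partial>lborel)"
proof -
  have a: "AE s in lborel. (\<lambda>n. head_part (Suc n) s) \<longlonglongrightarrow> limit_surv s - of_bool (s < 0)"
    by (intro AE_I2 head_part_tendsto)
  have b: "AE s in lborel. norm (head_part (Suc n) s) \<le> dominator s" for n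
    by (intro AE_I2 norm_head_part_le) simp
  have m: "(\<lambda>s. limit_surv s - of_bool (s < 0)) \<in> borel_measurable lborel"
    "head_part n \<in> borel_measurable lborel" for n by measurable
  show "integrable lborel (\<lambda>s. limit_surv s - of_bool (s < 0))"
    by (rule integrable_dominated_convergence[OF m integrable_dominator a b])
  have "(\<lambda>n. \<integral>s. head_part (Suc n) s \<partial>lborel) \<longlonglongrightarrow> (\<integral>s. limit_surv s - of_bool (s < 0) \<partial>lborel)"
    by (rule integral_dominated_convergence[OF m integrable_dominator a b])
  from tendsto_add[OF this integral_tail_part_tendsto]
  show "(\<lambda>n. \<integral>s. scaled_surv (Suc n) s - of_bool (s < 0) \<partial>lborel)
      \<longlonglongrightarrow> (\<integral>s. limit_surv s - of_bool (s < 0) \<partial>lborel)"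
    unfolding split_parts by (simp add: integrable_head_part integrable_tail_part)
qed

text \<open>\<open>layer_cake\<close> is applied to ln u - ln (f x) under the product of D and the
  standard exponential law. The mean of ln u is - \<gamma> by
  \<open>euler_mascheroni_integral\<close>.\<close>

lemma entropy_integral:
  shows "integrable lborel (\<lambda>x. f x * ln (f x))"
    and "(\<integral>s. limit_surv s - of_bool (s < 0) \<partial>lborel) = - euler_mascheroni + shannon_entropy f"
proof -
  define E :: "real measure" where "E = density lborel (\<lambda>u. ennreal (exponential_density 1 u))"
  interpret E: prob_space E unfolding E_def by (rule prob_space_exponential_density) simp
  have [measurable_cong, simp]: "sets E = sets borel" by (simp add: E_def)
  have [simp]: "space E = UNIV" by (simp add: E_def)
  interpret P: pair_prob_space D E ..
  define L where "L = (\<lambda>(x, u). ln u - ln (f x))"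
  have L [measurable]: "L \<in> borel_measurable (D \<Otimes>\<^sub>M E)" unfolding L_def by measurable
  have E_gt: "measure E {a<..} = exp (- a)" if "0 \<le> a" for a
  proof -
    have "distributed E lborel (\<lambda>u. u) (exponential_density 1)"
      unfolding distributed_def
      by (auto simp: E_def exponential_density_nonneg intro!: distr_id2)
    from E.exponential_distributedD_gt[OF this that] show ?thesis
      by (simp add: greaterThan_def)
  qed
  have E_pos: "AE u in E. 0 < u"
    unfolding E_def by (subst AE_density) (use AE_lborel_singleton[of 0] in \<open>auto simp: exponential_density_def elim!: eventually_mono\<close>)
  have S: "measure (D \<Otimes>\<^sub>M E) {z \<in> space (D \<Otimes>\<^sub>M E). s < L z} = limit_surv s" for s
  proof -
    let ?A = "{z \<in> space (D \<Otimes>\<^sub>M E). s < L z}"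
    have int: "integrable D (\<lambda>x. exp (- (exp s * f x)))"
      by (rule D.integrable_const_bound[where B=1]) (auto simp: nonneg)
    have "emeasure (D \<Otimes>\<^sub>M E) ?A = (\<integral>\<^sup>+x. emeasure E (Pair x -` ?A) \<partial>D)"
      by (rule E.emeasure_pair_measure_alt) measurable
    also have "\<dots> = (\<integral>\<^sup>+x. ennreal (exp (- (exp s * f x))) \<partial>D)"
    \<comment> \<open>Only where f x > 0 can the inequality between logarithms be rewritten as u >
      exp s * f x.\<close>
    proof (rule nn_integral_cong_AE, use AE_D_pos in eventually_elim)
      case (elim x)
      have "emeasure E (Pair x -` ?A) = emeasure E {exp s * f x<..}"
      proof (rule emeasure_eq_AE)
        show "AE u in E. u \<in> Pair x -` ?A \<longleftrightarrow> u \<in> {exp s * f x<..}"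
          using E_pos
        proof eventually_elim
          case (elim u)
          have "s < ln u - ln (f x) \<longleftrightarrow> ln (exp s * f x) < ln u"
            using \<open>0 < f x\<close> by (auto simp: ln_mult)
          also have "\<dots> \<longleftrightarrow> exp s * f x < u"
            using \<open>0 < f x\<close> elim by (subst ln_less_cancel_iff) auto
          finally show ?case by (simp add: L_def space_pair_measure)
        qed
        show "Pair x -` ?A \<in> sets E" by measurable
      qed simp
      also have "\<dots> = ennreal (exp (- (exp s * f x)))"
        using elim by (simp add: E.emeasure_eq_measure E_gt)
      finally show ?case .
    qed
    also have "\<dots> = ennreal (limit_surv s)"
      unfolding limit_surv_def by (rule nn_integral_eq_integral[OF int]) simp
    finally show ?thesis
      by (simp add: measure_def limit_surv_def)
  qed
  have int_L: "integrable (D \<Otimes>\<^sub>M E) L"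
    by (rule P.layer_cake(1)[OF L]) (simp add: S limit_surv_integral(1))
  have exp_L: "(\<integral>z. L z \<partial>(D \<Otimes>\<^sub>M E)) = (\<integral>s. limit_surv s - of_bool (s < 0) \<partial>lborel)"
    by (subst P.layer_cake(2)[OF L]) (simp_all add: S limit_surv_integral(1))
  have eq: "exponential_density 1 u *\<^sub>R ln u = indicator {0..} u * (exp (- u) * ln u)" for u :: real
    by (auto simp: exponential_density_def indicator_def)
  have int_ln: "integrable E ln"
    unfolding E_def by (subst integrable_density) (simp_all only: eq euler_mascheroni_integral(1), simp_all add: exponential_density_nonneg)
  have exp_ln: "(\<integral>u. ln u \<partial>E) = - euler_mascheroni"
    unfolding E_def by (subst integral_density) (simp_all only: eq euler_mascheroni_integral(2)[symmetric], simp_all add: exponential_density_nonneg)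
  have int_ln2: "integrable (D \<Otimes>\<^sub>M E) (\<lambda>(x, u). ln u)"
    using int_ln by (intro P.Fubini_integrable) auto
  \<comment> \<open>Both ln u and L are integrable, hence so is ln (f x). Finiteness of the entropy
    is thus derived, not assumed.\<close>
  have "integrable (D \<Otimes>\<^sub>M E) (\<lambda>z. (case z of (x, u) \<Rightarrow> ln u) - L z)"
    using int_ln2 int_L by (rule Bochner_Integration.integrable_diff)
  also have "(\<lambda>z. (case z of (x, u) \<Rightarrow> ln u) - L z) = (\<lambda>(x, u). ln (f x))"
    by (auto simp: L_def fun_eq_iff)
  finally have int_f: "integrable (D \<Otimes>\<^sub>M E) (\<lambda>(x, u). ln (f x))" .
  have "integrable D (\<lambda>x. \<integral>u. ln (f x) \<partial>E)"
    using P.integrable_fst'[OF int_f] by simp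
  hence int_lnf: "integrable D (\<lambda>x. ln (f x))" using E.prob_space by simp
  thus "integrable lborel (\<lambda>x. f x * ln (f x))"
    unfolding D_def by (subst (asm) integrable_density) (auto simp: nonneg)
  have "(\<integral>z. L z \<partial>(D \<Otimes>\<^sub>M E)) = (\<integral>x. \<integral>u. ln u - ln (f x) \<partial>E \<partial>D)"
    using P.integral_fst'[OF int_L] by (simp add: L_def)
  also have "\<dots> = (\<integral>x. - euler_mascheroni - ln (f x) \<partial>D)"
    using int_ln E.prob_space by (simp add: exp_ln)
  also have "\<dots> = - euler_mascheroni - (\<integral>x. ln (f x) \<partial>D)"
    using int_lnf D.prob_space by simp
  also have "(\<integral>x. ln (f x) \<partial>D) = (\<integral>x. f x * ln (f x) \<partial>lborel)"
    unfolding D_def by (subst integral_density) (auto simp: nonneg)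
  finally show "(\<integral>s. limit_surv s - of_bool (s < 0) \<partial>lborel) = - euler_mascheroni + shannon_entropy f"
    by (simp add: exp_L shannon_entropy_def)
qed

subsection \<open>The estimate\<close>

context
  fixes M :: "'w measure" and X :: "nat \<Rightarrow> 'w \<Rightarrow> 'a"
  assumes M: "prob_space M"
    and indep: "prob_space.indep_vars M (\<lambda>_. borel) X {1..}"
    and law: "\<And>i. 1 \<le> i \<Longrightarrow> distr M borel (X i) = D"
begin

interpretation M: prob_space M by (rule M)

lemma X_measurable: "1 \<le> i \<Longrightarrow> X i \<in> borel_measurable M"
  using indep by (simp add: M.indep_vars_def)

lemma nn_dist_measurable [measurable]:
  assumes "i \<in> {1..N}"
  shows "(\<lambda>\<omega>. nn_dist N (\<lambda>i. X i \<omega>) i) \<in> borel_measurable M"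
proof -
  have "(\<lambda>\<omega>. dist (X i \<omega>) (X j \<omega>)) \<in> borel_measurable M" if "j \<in> {1..N} - {i}" for j
    using that assms by (intro borel_measurable_dist X_measurable) auto
  thus ?thesis unfolding nn_dist_def
    by (intro borel_measurable_Min) auto
qed

text \<open>Independence makes the joint law of the first N points a product of copies of D, so
  \<open>prob_all_far\<close> applies with the N - 1 other indices.\<close>

lemma prob_nn_dist:
  assumes i: "i \<in> {1..N}" and N: "2 \<le> N"
  shows "M.prob {\<omega> \<in> space M. r < nn_dist N (\<lambda>i. X i \<omega>) i} = surv (N - 1) r"
proof -
  let ?J = "{1..N} - {i}" and ?P = "PiM {1..N} (\<lambda>_. D)"
  let ?Y = "\<lambda>\<omega>. \<lambda>i\<in>{1..N}. X i \<omega>"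
  let ?A = "{x \<in> space ?P. \<forall>j\<in>?J. r < dist (x i) (x j)}"
  have ins: "insert i ?J = {1..N}" using i by auto
  have "M.indep_vars (\<lambda>_. borel) X {1..N}" by (rule M.indep_vars_subset[OF indep]) auto
  hence "distr M (PiM {1..N} (\<lambda>_. borel)) ?Y = PiM {1..N} (\<lambda>i. distr M borel (X i))"
    by (subst (asm) M.indep_vars_iff_distr_eq_PiM') (use N in \<open>auto intro: X_measurable\<close>)
  also have "\<dots> = ?P" by (intro PiM_cong) (auto simp: law)
  finally have P: "distr M (PiM {1..N} (\<lambda>_. borel)) ?Y = ?P" .
  have Y: "?Y \<in> measurable M (PiM {1..N} (\<lambda>_. borel))"
    by (intro measurable_restrict X_measurable) auto
  have s: "sets (PiM {1..N} (\<lambda>_. borel)) = sets ?P" by (intro sets_PiM_cong) auto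
  have A: "?A \<in> sets ?P"
    using i by measurable
  have "surv (N - 1) r = measure ?P ?A"
    using prob_all_far[of ?J i r, unfolded ins] i by simp
  also have "\<dots> = M.prob (?Y -` ?A \<inter> space M)"
    unfolding P[symmetric] by (rule measure_distr[OF Y]) (use A s P in simp)
  also have "?Y -` ?A \<inter> space M = {\<omega> \<in> space M. r < nn_dist N (\<lambda>i. X i \<omega>) i}"
    using i by (auto simp: less_nn_dist_iff[OF i N] space_PiM)
  finally show ?thesis by simp
qed

lemma AE_nn_dist_pos:
  assumes i: "i \<in> {1..N}" and N: "2 \<le> N"
  shows "AE \<omega> in M. 0 < nn_dist N (\<lambda>i. X i \<omega>) i"
  using prob_nn_dist[OF i N, of 0] nn_dist_measurable[OF i]
  by (subst M.prob_Collect_eq_1[symmetric]) (simp_all add: surv_0)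

text \<open>For a positive distance this is the logarithm of N - 1 times the volume of the ball
  reaching to the nearest neighbour.\<close>

definition log_ratio :: "nat \<Rightarrow> nat \<Rightarrow> 'w \<Rightarrow> real" where
  "log_ratio N i \<omega> = real DIM('a) * ln (nn_dist N (\<lambda>i. X i \<omega>) i)
     + ln (real (N - 1) * unit_ball_vol (real DIM('a)))"

text \<open>At positive distances, exceeding s means that the distance exceeds the radius for s. So
  the survival function is \<open>scaled_surv (N - 1)\<close>, and \<open>layer_cake\<close>
  applies.\<close>

lemma log_ratio_integral:
  assumes i: "i \<in> {1..N}" and N: "2 \<le> N"
  shows "integrable M (log_ratio N i)"
    and "M.expectation (log_ratio N i) = (\<integral>s. scaled_surv (N - 1) s - of_bool (s < 0) \<partial>lborel)"
proof -
  note [measurable] = nn_dist_measurable[OF i]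
  have m [measurable]: "log_ratio N i \<in> borel_measurable M"
    unfolding log_ratio_def[abs_def] by measurable
  have S: "M.prob {\<omega> \<in> space M. s < log_ratio N i \<omega>} = scaled_surv (N - 1) s" for s
  proof -
    have "M.prob {\<omega> \<in> space M. s < log_ratio N i \<omega>}
        = M.prob {\<omega> \<in> space M. nn_radius (N - 1) s < nn_dist N (\<lambda>i. X i \<omega>) i}"
    proof (rule M.finite_measure_eq_AE)
      show "AE \<omega> in M. \<omega> \<in> {\<omega> \<in> space M. s < log_ratio N i \<omega>}
         \<longleftrightarrow> \<omega> \<in> {\<omega> \<in> space M. nn_radius (N - 1) s < nn_dist N (\<lambda>i. X i \<omega>) i}"
        using AE_nn_dist_pos[OF i N]
      proof eventually_elim
        case (elim \<omega>)
        define d where "d = nn_dist N (\<lambda>i. X i \<omega>) i"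
        have d: "0 < d" using elim by (simp add: d_def)
        have "nn_radius (N - 1) s < d \<longleftrightarrow>
            (s - ln (real (N - 1) * unit_ball_vol (real DIM('a)))) / real DIM('a) < ln d"
          unfolding nn_radius_def using d by (subst ln_less_cancel_iff[symmetric]) auto
        also have "\<dots> \<longleftrightarrow> s < log_ratio N i \<omega>"
          unfolding log_ratio_def d_def[symmetric] by (auto simp: field_simps)
        finally show ?case by (simp add: d_def)
      qed
    qed measurable
    thus ?thesis using prob_nn_dist[OF i N] by (simp add: scaled_surv_def)
  qed
  have int: "integrable lborel (\<lambda>s. M.prob {\<omega> \<in> space M. s < log_ratio N i \<omega>} - of_bool (s < 0))"
    \<comment> \<open>The index is N - 1 = Suc (N - 2), a positive number as integrability
      requires.\<close>
    using integrable_scaled_surv[of "N - 2"] N unfolding S by (simp add: Suc_diff_Suc numeral_2_eq_2)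
  show "integrable M (log_ratio N i)" by (rule M.layer_cake(1)[OF m int])
  show "M.expectation (log_ratio N i) = (\<integral>s. scaled_surv (N - 1) s - of_bool (s < 0) \<partial>lborel)"
    using M.layer_cake(2)[OF m int] unfolding S .
qed

text \<open>Almost surely all distances are positive, so the logarithm of the geometric mean is the
  mean of the logarithms. All N terms have the same expectation.\<close>

lemma KL_estimate_integral:
  assumes N: "2 \<le> N"
  shows "integrable M (\<lambda>\<omega>. KL_estimate N (\<lambda>i. X i \<omega>))"
    and "M.expectation (\<lambda>\<omega>. KL_estimate N (\<lambda>i. X i \<omega>))
      = (\<integral>s. scaled_surv (N - 1) s - of_bool (s < 0) \<partial>lborel) + euler_mascheroni"
proof -
  define A where "A \<omega> = (\<Sum>i=1..N. log_ratio N i \<omega>) / real N + euler_mascheroni" for \<omega>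
  have int_sum: "integrable M (\<lambda>\<omega>. \<Sum>i=1..N. log_ratio N i \<omega>)"
    by (intro Bochner_Integration.integrable_sum log_ratio_integral(1) N)
  hence int_A: "integrable M A"
    unfolding A_def by (intro Bochner_Integration.integrable_add integrable_divide) auto
  have m: "(\<lambda>\<omega>. KL_estimate N (\<lambda>i. X i \<omega>)) \<in> borel_measurable M"
  proof -
    have "(\<lambda>\<omega>. \<Prod>i=1..N. nn_dist N (\<lambda>i. X i \<omega>) i) \<in> borel_measurable M"
      by (intro borel_measurable_prod nn_dist_measurable)
    thus ?thesis unfolding KL_estimate_def by simp
  qed
  have "AE \<omega> in M. \<forall>i\<in>{1..N}. 0 < nn_dist N (\<lambda>i. X i \<omega>) i"
    by (rule AE_finite_allI) (auto intro: AE_nn_dist_pos N)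
  hence ae: "AE \<omega> in M. KL_estimate N (\<lambda>i. X i \<omega>) = A \<omega>"
  proof eventually_elim
    case (elim \<omega>)
    let ?d = "nn_dist N (\<lambda>i. X i \<omega>)"
    have "ln (\<Prod>i=1..N. ?d i) = (\<Sum>i=1..N. ln (?d i))"
      by (rule ln_prod) (use elim in \<open>auto dest!: bspec\<close>)
    hence "ln ((\<Prod>i=1..N. ?d i) powr (1 / real N)) = (\<Sum>i=1..N. ln (?d i)) / real N"
      by (simp add: ln_powr)
    moreover have "ln (real (N - 1) * unit_ball_vol (real DIM('a)))
        = ln (unit_ball_vol (real DIM('a))) + ln (real N - 1)"
      using N by (subst ln_mult) (auto simp: of_nat_diff)
    ultimately show ?case using N
      by (simp add: KL_estimate_def A_def log_ratio_def sum.distrib sum_distrib_left[symmetric] add_divide_distrib)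
  qed
  show "integrable M (\<lambda>\<omega>. KL_estimate N (\<lambda>i. X i \<omega>))"
    using integrable_cong_AE[THEN iffD2, OF m _ ae int_A] int_A by auto
  have "M.expectation (\<lambda>\<omega>. KL_estimate N (\<lambda>i. X i \<omega>)) = M.expectation A"
    using int_A by (intro integral_cong_AE m ae) auto
  also have "\<dots> = (\<Sum>i=1..N. M.expectation (log_ratio N i)) / real N + euler_mascheroni"
  proof -
    have "M.expectation (\<lambda>\<omega>. \<Sum>i=1..N. log_ratio N i \<omega>) = (\<Sum>i=1..N. M.expectation (log_ratio N i))"
      by (intro Bochner_Integration.integral_sum log_ratio_integral(1) N)
    thus ?thesis unfolding A_def
      by (subst Bochner_Integration.integral_add) (use int_sum M.prob_space in auto)
  qed
  also have "(\<Sum>i=1..N. M.expectation (log_ratio N i)) = real N * (\<integral>s. scaled_surv (N - 1) s - of_bool (s < 0) \<partial>lborel)"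
    by (simp add: log_ratio_integral(2)[OF _ N])
  finally show "M.expectation (\<lambda>\<omega>. KL_estimate N (\<lambda>i. X i \<omega>))
      = (\<integral>s. scaled_surv (N - 1) s - of_bool (s < 0) \<partial>lborel) + euler_mascheroni"
    using N by simp
qed

lemma KL_estimate_tendsto:
  "(\<lambda>N. M.expectation (\<lambda>\<omega>. KL_estimate N (\<lambda>i. X i \<omega>))) \<longlonglongrightarrow> shannon_entropy f"
\<comment> \<open>With N = n + 2 the index N - 1 becomes Suc n, and the two occurrences of \<gamma>
  cancel.\<close>
proof (rule LIMSEQ_offset[where k=2])
  have "(\<lambda>n. (\<integral>s. scaled_surv (Suc n) s - of_bool (s < 0) \<partial>lborel) + euler_mascheroni)
      \<longlonglongrightarrow> (- euler_mascheroni + shannon_entropy f) + euler_mascheroni"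
    using limit_surv_integral(2) by (intro tendsto_intros) (simp add: entropy_integral(2))
  thus "(\<lambda>n. M.expectation (\<lambda>\<omega>. KL_estimate (n + 2) (\<lambda>i. X i \<omega>))) \<longlonglongrightarrow> shannon_entropy f"
    by (simp add: KL_estimate_integral(2))
qed

end

end

text \<open>The two integrability claims guarantee that the entropy and the expectations for N \<ge>
  2 are genuine integrals and not the default value 0 of the Bochner integral.\<close>

theorem theorem1:
  fixes M :: "'w measure"
    and \<xi> :: "'w \<Rightarrow> 'a::euclidean_space"
    and X :: "nat \<Rightarrow> 'w \<Rightarrow> 'a"
    and f :: "'a \<Rightarrow> real"
    and \<epsilon>\<^sub>0 \<epsilon>\<^sub>1 \<epsilon>\<^sub>2 R\<^sub>1 R\<^sub>2 :: real
  assumes "prob_space M" and "complete_measure M"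
    and "\<And>x. 0 \<le> f x"
    and "distributed M lborel \<xi> (\<lambda>x. ennreal (f x))"
    and "prob_space.indep_vars M (\<lambda>_. borel) X {1..}"
    and "\<And>i. 1 \<le> i \<Longrightarrow> distr M borel (X i) = distr M borel \<xi>"
    and "0 < \<epsilon>\<^sub>0" and "0 < \<epsilon>\<^sub>1" and "0 < \<epsilon>\<^sub>2" and "0 < R\<^sub>1" and "0 < R\<^sub>2"
    and "K_fun f \<epsilon>\<^sub>0 < \<infinity>"
    and "Q_fun f \<epsilon>\<^sub>1 R\<^sub>1 < \<infinity>"
    and "T_fun f \<epsilon>\<^sub>2 R\<^sub>2 < \<infinity>"
  shows "integrable lborel (\<lambda>x. f x * ln (f x))
    \<and> (\<forall>N\<ge>2. integrable M (\<lambda>\<omega>. KL_estimate N (\<lambda>i. X i \<omega>)))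
    \<and> (\<lambda>N. prob_space.expectation M (\<lambda>\<omega>. KL_estimate N (\<lambda>i. X i \<omega>)))
        \<longlonglongrightarrow> shannon_entropy f"
proof -
  interpret M: prob_space M by fact
  have \<xi>: "\<xi> \<in> measurable M lborel" and D: "distr M lborel \<xi> = density lborel (\<lambda>x. ennreal (f x))"
    and fm: "(\<lambda>x. ennreal (f x)) \<in> borel_measurable lborel"
    using assms(4) by (auto simp: distributed_def)
  \<comment> \<open>Measurability of f itself is recovered from that of its extended version, as f
    is nonnegative.\<close>
  have "(\<lambda>x. enn2real (ennreal (f x))) \<in> borel_measurable borel" using fm by simp
  hence f: "f \<in> borel_measurable borel" using assms(3) by simp
  interpret P: prob_space "density lborel (\<lambda>x. ennreal (f x))"
    unfolding D[symmetric] by (rule M.prob_space_distr[OF \<xi>])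
  have "(\<integral>\<^sup>+x. ennreal (f x) \<partial>lborel) = 1"
    using P.emeasure_space_1 f by (simp add: emeasure_density)
  then interpret kl_density f \<epsilon>\<^sub>0 \<epsilon>\<^sub>1 \<epsilon>\<^sub>2 R\<^sub>1 R\<^sub>2
    by unfold_locales (use f assms in auto)
  have "distr M borel \<xi> = distr M lborel \<xi>" by (rule distr_cong) auto
  hence law: "distr M borel (X i) = D" if "1 \<le> i" for i
    using assms(6)[OF that] by (simp add: D D_def)
  show ?thesis
    using entropy_integral(1) KL_estimate_integral(1)[OF assms(1,5) law]
      KL_estimate_tendsto[OF assms(1,5) law] by blast
qed

end
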